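(* Let $\mathcal{T}$ be a compactly generated triangulated category with all small coproducts whose full subcategory $\mathcal{T}^{c}$ of compact objects is skeletally small. Let $M$ be an object of $\mathcal{T}$, let $X$ be an object of $\mathcal{T}^{c}$, and let $\mathcal{T}(-,X)|_{\mathcal{T}^{c}}\to\mathscr{Q}\to 0$ be an exact sequence in $\mathbf{Mod}\text{-}\mathcal{T}^{c}$. Then any strictly ascending chain $\mathscr{P}_{1}\subsetneq\mathscr{P}_{2}\subsetneq\cdots$ of $\mathbf{Y}(M)$-annihilator subobjects of $\mathscr{Q}$ gives rise to a strictly descending (infinite) chain of pp-definable subgroups of $M$ of sort $X$; that is, if a chain of the former kind exists then so does one of the latter kind.
   Context: An object $X$ of $\mathcal{T}$ is compact if for every set-indexed family $(M_i)$ of objects the canonical map $\coprod_i\mathcal{T}(X,M_i)\to\mathcal{T}(X,\coprod_i M_i)$ is an isomorphism. $\mathcal{T}$ (with suspension $\Sigma$) is compactly generated if there is a set $\mathcal{G}$ of compact objects, closed under $\Sigma$, such that $\mathcal{T}(X,M)=0$ for all $X\in\mathcal{G}$ implies $M=0$. $\mathbf{Mod}\text{-}\mathcal{T}^{c}$ is the category of contravariant additive functors $\mathcal{T}^{c}\to\mathbf{Ab}$, and $\mathbf{Y}\colon\mathcal{T}\to\mathbf{Mod}\text{-}\mathcal{T}^{c}$ is the restricted Yoneda functor $M\mapsto\mathcal{T}(-,M)|_{\mathcal{T}^{c}}$. For objects $\mathscr{Q},\mathscr{R}$ of $\mathbf{Mod}\text{-}\mathcal{T}^{c}$, an $\mathscr{R}$-annihilator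 subobject of $\mathscr{Q}$ is a subobject of the form $\bigcap_{\mathfrak{f}\in\mathtt{K}}\ker(\mathfrak{f})$ for some set $\mathtt{K}$ of morphisms $\mathscr{Q}\to\mathscr{R}$. A pp-definable subgroup of $M$ of sort $X$ is a subgroup of $\mathcal{T}(X,M)$ of the form $Mb=\{fb\mid f\in\mathcal{T}(Y,M)\}$ for some morphism $b\colon X\to Y$ in $\mathcal{T}^{c}$. *)

theory Defs
  imports "HOL-Algebra.Free_Abelian_Groups" "HOL-Library.Equipollence"
begin

section \<open>Smallness\<close>

text \<open>
  The set/class distinction is modelled by a predicate \<open>sml\<close> on the sets of elements of a type
  \<open>'u\<close>: small (set-indexed) families are the families indexed by some \<open>I :: 'u set\<close>
  with \<open>sml I\<close>. The conditions below hold for the members of a Grothendieck universe, as well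
  as for the sets of cardinality below any fixed uncountable regular cardinal; closure under power
  sets is not imposed, and neither are the hom-sets of a category required to be small.
\<close>

locale smallness =
  fixes sml :: "'u set \<Rightarrow> bool"
  assumes sml_lepoll: "\<lbrakk>sml A; B \<lesssim> A\<rbrakk> \<Longrightarrow> sml B"
    and sml_infinite: "\<exists>A. sml A \<and> infinite A"
    and sml_UN: "\<lbrakk>sml I; \<And>i. i \<in> I \<Longrightarrow> sml (F (i::'u))\<rbrakk> \<Longrightarrow> sml (\<Union>i\<in>I. F i)"

definition small_set :: "('u set \<Rightarrow> bool) \<Rightarrow> 'a set \<Rightarrow> bool"
  where "small_set sml S \<longleftrightarrow> (\<exists>A. sml A \<and> S \<lesssim> A)"


section \<open>Preadditive and additive categories\<close>

text \<open>
  Hom-groups are commutative groups in the sense of HOL-Algebra, hence written multiplicatively: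
  \<open>f \<otimes> g\<close> is the sum of two parallel morphisms, \<open>\<one>\<close> the zero morphism and \<open>inv f\<close> the negative of
  \<open>f\<close>. The hom-sets are pairwise disjoint, so that composition needs no object arguments.
\<close>

record ('o, 'm) add_cat =
  Obj :: "'o set"
  Hom :: "'o \<Rightarrow> 'o \<Rightarrow> 'm monoid"
  Ide :: "'o \<Rightarrow> 'm"
  Comp :: "'m \<Rightarrow> 'm \<Rightarrow> 'm"  (infixr "\<bullet>\<index>" 75)

abbreviation mor :: "('o, 'm, 'x) add_cat_scheme \<Rightarrow> 'o \<Rightarrow> 'o \<Rightarrow> 'm set"
  where "mor A X Y \<equiv> carrier (Hom A X Y)"

abbreviation zero_mor :: "('o, 'm, 'x) add_cat_scheme \<Rightarrow> 'o \<Rightarrow> 'o \<Rightarrow> 'm"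
  where "zero_mor A X Y \<equiv> \<one>\<^bsub>Hom A X Y\<^esub>"

locale preadditive_category =
  fixes A :: "('o, 'm, 'x) add_cat_scheme" (structure)
  assumes Hom_group: "\<lbrakk>X \<in> Obj A; Y \<in> Obj A\<rbrakk> \<Longrightarrow> comm_group (Hom A X Y)"
    and Hom_disjoint: "\<lbrakk>X \<in> Obj A; Y \<in> Obj A; X' \<in> Obj A; Y' \<in> Obj A;
          mor A X Y \<inter> mor A X' Y' \<noteq> {}\<rbrakk> \<Longrightarrow> X = X' \<and> Y = Y'"
    and Id_mor: "X \<in> Obj A \<Longrightarrow> Ide A X \<in> mor A X X"
    and Comp_mor: "\<lbrakk>X \<in> Obj A; Y \<in> Obj A; Z \<in> Obj A; f \<in> mor A X Y; g \<in> mor A Y Z\<rbrakk>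
          \<Longrightarrow> g \<bullet> f \<in> mor A X Z"
    and Comp_Id: "\<lbrakk>X \<in> Obj A; Y \<in> Obj A; f \<in> mor A X Y\<rbrakk> \<Longrightarrow> f \<bullet> Ide A X = f"
    and Id_Comp: "\<lbrakk>X \<in> Obj A; Y \<in> Obj A; f \<in> mor A X Y\<rbrakk> \<Longrightarrow> Ide A Y \<bullet> f = f"
    and Comp_assoc: "\<lbrakk>W \<in> Obj A; X \<in> Obj A; Y \<in> Obj A; Z \<in> Obj A;
          f \<in> mor A W X; g \<in> mor A X Y; h \<in> mor A Y Z\<rbrakk> \<Longrightarrow> (h \<bullet> g) \<bullet> f = h \<bullet> (g \<bullet> f)"
    and Comp_add_left: "\<lbrakk>X \<in> Obj A; Y \<in> Obj A; Z \<in> Obj A;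
          f \<in> mor A X Y; g \<in> mor A Y Z; g' \<in> mor A Y Z\<rbrakk>
          \<Longrightarrow> (g \<otimes>\<^bsub>Hom A Y Z\<^esub> g') \<bullet> f = (g \<bullet> f) \<otimes>\<^bsub>Hom A X Z\<^esub> (g' \<bullet> f)"
    and Comp_add_right: "\<lbrakk>X \<in> Obj A; Y \<in> Obj A; Z \<in> Obj A;
          f \<in> mor A X Y; f' \<in> mor A X Y; g \<in> mor A Y Z\<rbrakk>
          \<Longrightarrow> g \<bullet> (f \<otimes>\<^bsub>Hom A X Y\<^esub> f') = (g \<bullet> f) \<otimes>\<^bsub>Hom A X Z\<^esub> (g \<bullet> f')"

definition isomorphism :: "('o, 'm, 'x) add_cat_scheme \<Rightarrow> 'o \<Rightarrow> 'o \<Rightarrow> 'm \<Rightarrow> bool"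
  where "isomorphism A X Y f \<longleftrightarrow> f \<in> mor A X Y \<and>
    (\<exists>g \<in> mor A Y X. g \<bullet>\<^bsub>A\<^esub> f = Ide A X \<and> f \<bullet>\<^bsub>A\<^esub> g = Ide A Y)"

definition isomorphic :: "('o, 'm, 'x) add_cat_scheme \<Rightarrow> 'o \<Rightarrow> 'o \<Rightarrow> bool"
  where "isomorphic A X Y \<longleftrightarrow> (\<exists>f. isomorphism A X Y f)"

definition zero_object :: "('o, 'm, 'x) add_cat_scheme \<Rightarrow> 'o \<Rightarrow> bool"
  where "zero_object A Z \<longleftrightarrow> Z \<in> Obj A \<and>
    (\<forall>X \<in> Obj A. mor A X Z = {zero_mor A X Z} \<and> mor A Z X = {zero_mor A Z X})"

definition is_coproduct ::
    "('o, 'm, 'x) add_cat_scheme \<Rightarrow> 'i set \<Rightarrow> ('i \<Rightarrow> 'o) \<Rightarrow> 'o \<Rightarrow> ('i \<Rightarrow> 'm) \<Rightarrow> bool"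
  where "is_coproduct A I M C \<iota> \<longleftrightarrow> C \<in> Obj A \<and> (\<forall>i\<in>I. \<iota> i \<in> mor A (M i) C) \<and>
    (\<forall>N \<in> Obj A. \<forall>g. (\<forall>i\<in>I. g i \<in> mor A (M i) N) \<longrightarrow>
      (\<exists>!h. h \<in> mor A C N \<and> (\<forall>i\<in>I. h \<bullet>\<^bsub>A\<^esub> \<iota> i = g i)))"

locale additive_category = preadditive_category A
  for A :: "('o, 'm, 'x) add_cat_scheme" (structure) +
  assumes ex_zero_object: "\<exists>Z. zero_object A Z"
    and ex_binary_coproduct: "\<lbrakk>X \<in> Obj A; Y \<in> Obj A\<rbrakk>
          \<Longrightarrow> \<exists>C \<iota>. is_coproduct A (UNIV :: bool set) (\<lambda>b. if b then X else Y) C \<iota>"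

definition full_subcategory :: "('o, 'm, 'x) add_cat_scheme \<Rightarrow> 'o set \<Rightarrow> ('o, 'm) add_cat"
  where "full_subcategory A S = \<lparr>Obj = S, Hom = Hom A, Ide = Ide A, Comp = Comp A\<rparr>"

definition has_small_coproducts ::
    "('u set \<Rightarrow> bool) \<Rightarrow> ('o, 'm, 'x) add_cat_scheme \<Rightarrow> bool"
  where "has_small_coproducts sml A \<longleftrightarrow>
    (\<forall>I M. sml I \<and> (\<forall>i\<in>I. M i \<in> Obj A) \<longrightarrow> (\<exists>C \<iota>. is_coproduct A I M C \<iota>))"

definition skeletally_small ::
    "('u set \<Rightarrow> bool) \<Rightarrow> ('o, 'm, 'x) add_cat_scheme \<Rightarrow> bool"
  where "skeletally_small sml A \<longleftrightarrow>
    (\<exists>S \<subseteq> Obj A. small_set sml S \<and> (\<forall>X \<in> Obj A. \<exists>Y \<in> S. isomorphic A X Y))"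


section \<open>Triangulated categories\<close>

text \<open>
  \<open>Sus\<close> and \<open>SusM\<close> are the object and the morphism part of the suspension, an additive
  autoequivalence; \<open>Tri T X Y Z u v w\<close> says that \<open>X \<rightarrow> Y \<rightarrow> Z \<rightarrow> \<Sigma>X\<close>, with maps \<open>u\<close>, \<open>v\<close>, \<open>w\<close>, is a
  distinguished triangle.
\<close>

record ('o, 'm) tri_cat = "('o, 'm) add_cat" +
  Sus :: "'o \<Rightarrow> 'o"
  SusM :: "'m \<Rightarrow> 'm"
  Tri :: "'o \<Rightarrow> 'o \<Rightarrow> 'o \<Rightarrow> 'm \<Rightarrow> 'm \<Rightarrow> 'm \<Rightarrow> bool"

definition candidate_triangle ::
    "('o, 'm, 'x) tri_cat_scheme \<Rightarrow> 'o \<Rightarrow> 'o \<Rightarrow> 'o \<Rightarrow> 'm \<Rightarrow> 'm \<Rightarrow> 'm \<Rightarrow> bool"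
  where "candidate_triangle T X Y Z u v w \<longleftrightarrow> X \<in> Obj T \<and> Y \<in> Obj T \<and> Z \<in> Obj T \<and>
    u \<in> mor T X Y \<and> v \<in> mor T Y Z \<and> w \<in> mor T Z (Sus T X)"

locale triangulated_category = additive_category T
  for T :: "('o, 'm, 'x) tri_cat_scheme" (structure) +
  assumes Sus_Obj: "X \<in> Obj T \<Longrightarrow> Sus T X \<in> Obj T"
    and SusM_Id: "X \<in> Obj T \<Longrightarrow> SusM T (Ide T X) = Ide T (Sus T X)"
    and SusM_Comp: "\<lbrakk>X \<in> Obj T; Y \<in> Obj T; Z \<in> Obj T; f \<in> mor T X Y; g \<in> mor T Y Z\<rbrakk>
          \<Longrightarrow> SusM T (g \<bullet> f) = SusM T g \<bullet> SusM T f"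
    and SusM_fully_faithful: "\<lbrakk>X \<in> Obj T; Y \<in> Obj T\<rbrakk>
          \<Longrightarrow> SusM T \<in> iso (Hom T X Y) (Hom T (Sus T X) (Sus T Y))"
    and Sus_essentially_surjective:
          "Y \<in> Obj T \<Longrightarrow> \<exists>X \<in> Obj T. isomorphic T (Sus T X) Y"
    and Tri_candidate: "Tri T X Y Z u v w \<Longrightarrow> candidate_triangle T X Y Z u v w"
    and Tri_isomorphism: "\<lbrakk>Tri T X Y Z u v w; candidate_triangle T X' Y' Z' u' v' w';
          isomorphism T X X' a; isomorphism T Y Y' b; isomorphism T Z Z' c;
          b \<bullet> u = u' \<bullet> a; c \<bullet> v = v' \<bullet> b; SusM T a \<bullet> w = w' \<bullet> c\<rbrakk>
          \<Longrightarrow> Tri T X' Y' Z' u' v' w'"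
    and Tri_Id: "\<lbrakk>X \<in> Obj T; zero_object T Z\<rbrakk>
          \<Longrightarrow> Tri T X X Z (Ide T X) (zero_mor T X Z) (zero_mor T Z (Sus T X))"
    and Tri_cone: "\<lbrakk>X \<in> Obj T; Y \<in> Obj T; u \<in> mor T X Y\<rbrakk> \<Longrightarrow> \<exists>Z v w. Tri T X Y Z u v w"
    and Tri_rotate: "candidate_triangle T X Y Z u v w \<Longrightarrow>
          Tri T X Y Z u v w \<longleftrightarrow>
          Tri T Y Z (Sus T X) v w (inv\<^bsub>Hom T (Sus T X) (Sus T Y)\<^esub> (SusM T u))"
    and Tri_fill: "\<lbrakk>Tri T X Y Z u v w; Tri T X' Y' Z' u' v' w';
          f \<in> mor T X X'; g \<in> mor T Y Y'; g \<bullet> u = u' \<bullet> f\<rbrakk>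
          \<Longrightarrow> \<exists>h \<in> mor T Z Z'. h \<bullet> v = v' \<bullet> g \<and> SusM T f \<bullet> w = w' \<bullet> h"
    and Tri_octahedral: "\<lbrakk>Tri T X Y Z' u i i'; Tri T Y Z X' v j j'; Tri T X Z Y' (v \<bullet> u) k k'\<rbrakk>
          \<Longrightarrow> \<exists>f g. Tri T Z' Y' X' f g (SusM T i \<bullet> j') \<and>
                f \<bullet> i = k \<bullet> v \<and> k' \<bullet> f = i' \<and> g \<bullet> k = j \<and> j' \<bullet> g = SusM T u \<bullet> k'"

text \<open>
  An element of the direct sum of the groups \<open>Hom(X, M i)\<close> is a finitely supported family \<open>x\<close>; the
  canonical map sends it to the sum of the composites \<open>\<iota> i \<bullet> x i\<close>. The library's \<open>gfinprod\<close> is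
  the sum over an infinite index set of a family with finite support.
\<close>

definition compact_object ::
    "('u set \<Rightarrow> bool) \<Rightarrow> ('o, 'm, 'x) add_cat_scheme \<Rightarrow> 'o \<Rightarrow> bool"
  where "compact_object sml A X \<longleftrightarrow> X \<in> Obj A \<and>
    (\<forall>I M C \<iota>. sml I \<and> (\<forall>i\<in>I. M i \<in> Obj A) \<and> is_coproduct A I M C \<iota> \<longrightarrow>
      (\<lambda>x. gfinprod (Hom A X C) (\<lambda>i. \<iota> i \<bullet>\<^bsub>A\<^esub> x i) I)
        \<in> iso (sum_group I (\<lambda>i. Hom A X (M i))) (Hom A X C))"

definition compacts :: "('u set \<Rightarrow> bool) \<Rightarrow> ('o, 'm, 'x) add_cat_scheme \<Rightarrow> ('o, 'm) add_cat"
  where "compacts sml A = full_subcategory A {X. compact_object sml A X}"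

definition compactly_generated ::
    "('u set \<Rightarrow> bool) \<Rightarrow> ('o, 'm, 'x) tri_cat_scheme \<Rightarrow> bool"
  where "compactly_generated sml T \<longleftrightarrow>
    (\<exists>G. small_set sml G \<and> (\<forall>X\<in>G. compact_object sml T X) \<and> (\<forall>X\<in>G. Sus T X \<in> G) \<and>
      (\<forall>M \<in> Obj T. (\<forall>X\<in>G. mor T X M = {zero_mor T X M}) \<longrightarrow> zero_object T M))"


section \<open>Modules over a preadditive category\<close>

text \<open>
  A module over \<open>A\<close> is a contravariant additive functor from \<open>A\<close> to abelian groups: \<open>Grp Q X\<close> is
  its value at \<open>X\<close>, and \<open>Act Q f\<close> is the map \<open>Grp Q Y \<rightarrow> Grp Q X\<close> induced by \<open>f : X \<rightarrow> Y\<close>.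
\<close>

record ('o, 'm, 'q) cat_module =
  Grp :: "'o \<Rightarrow> 'q monoid"
  Act :: "'m \<Rightarrow> 'q \<Rightarrow> 'q"

locale right_module = preadditive_category A
  for A :: "('o, 'm, 'x) add_cat_scheme" (structure) +
  fixes Q :: "('o, 'm, 'q) cat_module"
  assumes Grp_group: "X \<in> Obj A \<Longrightarrow> comm_group (Grp Q X)"
    and Act_hom: "\<lbrakk>X \<in> Obj A; Y \<in> Obj A; f \<in> mor A X Y\<rbrakk> \<Longrightarrow> Act Q f \<in> hom (Grp Q Y) (Grp Q X)"
    and Act_Id: "\<lbrakk>X \<in> Obj A; q \<in> carrier (Grp Q X)\<rbrakk> \<Longrightarrow> Act Q (Ide A X) q = q"
    and Act_Comp: "\<lbrakk>X \<in> Obj A; Y \<in> Obj A; Z \<in> Obj A; f \<in> mor A X Y; g \<in> mor A Y Z;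
          q \<in> carrier (Grp Q Z)\<rbrakk> \<Longrightarrow> Act Q (g \<bullet> f) q = Act Q f (Act Q g q)"
    and Act_add: "\<lbrakk>X \<in> Obj A; Y \<in> Obj A; f \<in> mor A X Y; g \<in> mor A X Y; q \<in> carrier (Grp Q Y)\<rbrakk>
          \<Longrightarrow> Act Q (f \<otimes>\<^bsub>Hom A X Y\<^esub> g) q = Act Q f q \<otimes>\<^bsub>Grp Q X\<^esub> Act Q g q"

definition module_mor :: "('o, 'm, 'x) add_cat_scheme \<Rightarrow> ('o, 'm, 'q) cat_module \<Rightarrow>
    ('o, 'm, 'r) cat_module \<Rightarrow> ('o \<Rightarrow> 'q \<Rightarrow> 'r) set"
  where "module_mor A Q R = {\<eta>.
    (\<forall>X \<in> Obj A. \<eta> X \<in> hom (Grp Q X) (Grp R X)) \<and>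
    (\<forall>X \<in> Obj A. \<forall>Y \<in> Obj A. \<forall>f \<in> mor A X Y. \<forall>q \<in> carrier (Grp Q Y).
      \<eta> X (Act Q f q) = Act R f (\<eta> Y q))}"

text \<open>
  Subobjects of a module are represented by subfunctors, i.e. families of subgroups stable under
  the action; only their values at the objects of \<open>A\<close> matter. Kernels, images and intersections
  of subobjects are computed objectwise.
\<close>

definition submodule :: "('o, 'm, 'x) add_cat_scheme \<Rightarrow> ('o, 'm, 'q) cat_module \<Rightarrow>
    ('o \<Rightarrow> 'q set) \<Rightarrow> bool"
  where "submodule A Q P \<longleftrightarrow>
    (\<forall>X \<in> Obj A. subgroup (P X) (Grp Q X)) \<and>
    (\<forall>X \<in> Obj A. \<forall>Y \<in> Obj A. \<forall>f \<in> mor A X Y. Act Q f ` P Y \<subseteq> P X)"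

definition proper_submodule :: "('o, 'm, 'x) add_cat_scheme \<Rightarrow> ('o \<Rightarrow> 'q set) \<Rightarrow>
    ('o \<Rightarrow> 'q set) \<Rightarrow> bool"
  where "proper_submodule A P P' \<longleftrightarrow>
    (\<forall>X \<in> Obj A. P X \<subseteq> P' X) \<and> (\<exists>X \<in> Obj A. P X \<noteq> P' X)"

definition ker_mor :: "('o, 'm, 'q) cat_module \<Rightarrow> ('o, 'm, 'r) cat_module \<Rightarrow>
    ('o \<Rightarrow> 'q \<Rightarrow> 'r) \<Rightarrow> 'o \<Rightarrow> 'q set"
  where "ker_mor Q R \<eta> X = kernel (Grp Q X) (Grp R X) (\<eta> X)"

definition im_mor :: "('o, 'm, 'q) cat_module \<Rightarrow> ('o \<Rightarrow> 'q \<Rightarrow> 'r) \<Rightarrow> 'o \<Rightarrow> 'r set"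
  where "im_mor Q \<eta> X = \<eta> X ` carrier (Grp Q X)"

definition exact_at :: "('o, 'm, 'x) add_cat_scheme \<Rightarrow> ('o, 'm, 'p) cat_module \<Rightarrow>
    ('o, 'm, 'q) cat_module \<Rightarrow> ('o, 'm, 'r) cat_module \<Rightarrow>
    ('o \<Rightarrow> 'p \<Rightarrow> 'q) \<Rightarrow> ('o \<Rightarrow> 'q \<Rightarrow> 'r) \<Rightarrow> bool"
  where "exact_at A P Q R \<alpha> \<beta> \<longleftrightarrow> \<alpha> \<in> module_mor A P Q \<and> \<beta> \<in> module_mor A Q R \<and>
    (\<forall>X \<in> Obj A. im_mor P \<alpha> X = ker_mor Q R \<beta> X)"

definition zero_module :: "('o, 'm, unit) cat_module"
  where "zero_module = \<lparr>Grp = (\<lambda>_. singleton_group ()), Act = (\<lambda>_ _. ())\<rparr>"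

text \<open>The meet of the empty set of subobjects of \<open>Q\<close> is \<open>Q\<close> itself.\<close>

definition annihilator_subobject :: "('o, 'm, 'x) add_cat_scheme \<Rightarrow> ('o, 'm, 'q) cat_module \<Rightarrow>
    ('o, 'm, 'r) cat_module \<Rightarrow> ('o \<Rightarrow> 'q set) \<Rightarrow> bool"
  where "annihilator_subobject A Q R P \<longleftrightarrow> submodule A Q P \<and>
    (\<exists>K \<subseteq> module_mor A Q R.
      \<forall>X \<in> Obj A. P X = carrier (Grp Q X) \<inter> (\<Inter>\<eta>\<in>K. ker_mor Q R \<eta> X))"

text \<open>
  The functor \<open>Hom(-, M)\<close>. It is the restricted Yoneda functor at \<open>M\<close> when regarded as a module
  over \<open>compacts sml T\<close>.
\<close>

definition yoneda :: "('o, 'm, 'x) add_cat_scheme \<Rightarrow> 'o \<Rightarrow> ('o, 'm, 'm) cat_module"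
  where "yoneda A M = \<lparr>Grp = (\<lambda>X. Hom A X M), Act = (\<lambda>f g. g \<bullet>\<^bsub>A\<^esub> f)\<rparr>"


section \<open>pp-definable subgroups\<close>

definition pp_definable_subgroup :: "('u set \<Rightarrow> bool) \<Rightarrow> ('o, 'm, 'x) add_cat_scheme \<Rightarrow>
    'o \<Rightarrow> 'o \<Rightarrow> 'm set \<Rightarrow> bool"
  where "pp_definable_subgroup sml A M X H \<longleftrightarrow> subgroup H (Hom A X M) \<and>
    (\<exists>Y \<in> Obj (compacts sml A). \<exists>b \<in> mor (compacts sml A) X Y.
      H = {f \<bullet>\<^bsub>A\<^esub> b | f. f \<in> mor A Y M})"

end

theory Submission
  imports Defs
begin

text \<open>
  Two facts drive the proof. The first is that a strict step in the chain of annihilators can be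
  witnessed by compact data. Choose an element \<open>q\<close> of the \<open>(n+1)\<close>-st subobject, in sort \<open>D n\<close>, that
  does not lie in the \<open>n\<close>-th one; as the \<open>n\<close>-th subobject is an intersection of kernels, some
  morphism \<open>\<eta>\<close> into the functor represented by \<open>M\<close> kills that subobject but not \<open>q\<close>. Since \<open>\<pi>\<close> is
  onto, \<open>q\<close> is the image of some \<open>a n : D n \<rightarrow> X\<close>, and since \<open>X\<close> is compact, the Yoneda lemma
  (\<open>yoneda_morphism\<close>) turns the composite of \<open>\<pi>\<close> and \<open>\<eta>\<close> into a morphism \<open>g n : X \<rightarrow> M\<close>.
  So the composite of \<open>a n\<close> and \<open>g n\<close> is nonzero, whereas the composite of \<open>a k\<close> and \<open>g n\<close> vanishes for
  \<open>k < n\<close>, because the image of \<open>a k\<close> already lies in the \<open>n\<close>-th subobject. Hence the groups \<open>H n\<close> of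
  the morphisms \<open>X \<rightarrow> M\<close> that annihilate \<open>a 0, \<dots>, a (n-1)\<close> form a strictly descending chain: \<open>g n\<close>
  lies in \<open>H n\<close> but not in \<open>H (n+1)\<close>.

  The second fact is that such an annihilator is pp-definable (\<open>annihilator_eq_multiples\<close>). For a
  triangle \<open>D \<rightarrow> X \<rightarrow> Y \<rightarrow> \<Sigma>D\<close> the second map is a weak cokernel of the first, so the morphisms \<open>X \<rightarrow> M\<close>
  that vanish on \<open>D\<close> are precisely those that factor through \<open>Y\<close>; finitely many annihilation
  conditions are imposed one after the other, each by one further cone.

  What makes this a statement about compact objects is that a cone of a morphism between
  compact objects is compact (\<open>compact_cone\<close>). The map from the coproduct of the \<open>Hom(X, M i)\<close> to
  \<open>Hom(X, \<Coprod>M i)\<close> is injective for every \<open>X\<close>, since a coproduct has projections onto its summands.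
  So compactness means that every morphism into a coproduct is a finite sum of
  morphisms into the summands (\<open>compact_object_iff_component_sums\<close>), and this passes to cones by a diagram
  chase as for the surjectivity half of the four lemma. The chase involves the suspension of a compact
  object, which is compact because coproducts can be desuspended (\<open>compact_Sus\<close>).
\<close>

section \<open>Finitely supported sums under homomorphisms\<close>

lemma hom_gfinprod:
  assumes G: "comm_group G" and H: "comm_group H" and h: "h \<in> hom G H"
    and x: "\<And>i. i \<in> I \<Longrightarrow> x i \<in> carrier G" and fin: "finite {i \<in> I. x i \<noteq> \<one>\<^bsub>G\<^esub>}"
  shows "h (gfinprod G x I) = gfinprod H (\<lambda>i. h (x i)) I"
proof -
  interpret G: comm_group G by (rule G)
  interpret H: comm_group H by (rule H)
  interpret h: group_hom G H h
    using h by unfold_locales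
  let ?S = "{i \<in> I. x i \<noteq> \<one>\<^bsub>G\<^esub>}"
  have fin_case: "h (finprod G x F) = finprod H (\<lambda>i. h (x i)) F" if "finite F" "F \<subseteq> I" for F
    using that
  proof (induction F)
    case (insert i F)
    then have "x \<in> F \<rightarrow> carrier G" "x i \<in> carrier G"
      using x by auto
    then show ?case
      using insert by (simp add: Pi_def)
  qed simp
  have "h (gfinprod G x I) = h (finprod G x ?S)"
    using fin by (simp add: gfinprod_def)
  also have "\<dots> = finprod H (\<lambda>i. h (x i)) ?S"
    using fin_case[OF fin] by blast
  also have "\<dots> = gfinprod H (\<lambda>i. h (x i)) ?S"
    by (rule H.gfinprod_eq_finprod[symmetric]) (use fin x in auto)
  also have "\<dots> = gfinprod H (\<lambda>i. h (x i)) I"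
    by (rule H.gfinprod_mono_neutral_cong_left) (use x in auto)
  finally show ?thesis .
qed

lemma (in comm_monoid) gfinprod_delta:
  assumes "j \<in> I" "f \<in> I \<rightarrow> carrier G" "\<And>i. i \<in> I \<Longrightarrow> i \<noteq> j \<Longrightarrow> f i = \<one>"
  shows "gfinprod G f I = f j"
proof -
  have "gfinprod G f I = gfinprod G f {j}"
    by (rule gfinprod_mono_neutral_cong_right) (use assms in auto)
  also have "\<dots> = f j"
    using assms by (subst gfinprod_eq_finprod) (auto simp: Pi_def)
  finally show ?thesis .
qed


section \<open>Composition in preadditive categories\<close>

context preadditive_category
begin

lemma comp_left_hom:
  assumes "X \<in> Obj A" "Y \<in> Obj A" "Z \<in> Obj A" "g \<in> mor A Y Z"
  shows "(\<lambda>f. g \<bullet> f) \<in> hom (Hom A X Y) (Hom A X Z)"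
  using assms by (auto intro!: homI Comp_mor[where Y = Y] Comp_add_right)

lemma comp_right_hom:
  assumes "X \<in> Obj A" "Y \<in> Obj A" "Z \<in> Obj A" "f \<in> mor A X Y"
  shows "(\<lambda>g. g \<bullet> f) \<in> hom (Hom A Y Z) (Hom A X Z)"
  using assms by (auto intro!: homI Comp_mor[where Y = Y] Comp_add_left)

lemma Hom_is_group: "X \<in> Obj A \<Longrightarrow> Y \<in> Obj A \<Longrightarrow> group (Hom A X Y)"
  using Hom_group by (rule comm_group.axioms(2))

lemma zero_mor_closed: "X \<in> Obj A \<Longrightarrow> Y \<in> Obj A \<Longrightarrow> zero_mor A X Y \<in> mor A X Y"
  by (simp add: Hom_is_group group.is_monoid)

lemma comp_zero:
  "X \<in> Obj A \<Longrightarrow> Y \<in> Obj A \<Longrightarrow> Z \<in> Obj A \<Longrightarrow> g \<in> mor A Y Z \<Longrightarrow>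
    g \<bullet> zero_mor A X Y = zero_mor A X Z"
  using hom_one[OF comp_left_hom Hom_is_group Hom_is_group] .

lemma zero_comp:
  "X \<in> Obj A \<Longrightarrow> Y \<in> Obj A \<Longrightarrow> Z \<in> Obj A \<Longrightarrow> f \<in> mor A X Y \<Longrightarrow>
    zero_mor A Y Z \<bullet> f = zero_mor A X Z"
  using hom_one[OF comp_right_hom Hom_is_group Hom_is_group] .

lemma zero_objectI:
  assumes Z: "Z \<in> Obj A" and id: "Ide A Z = zero_mor A Z Z"
  shows "zero_object A Z"
proof -
  have "f = zero_mor A X Z" if "X \<in> Obj A" "f \<in> mor A X Z" for X f
    using Id_Comp[OF that(1) Z that(2)] zero_comp[OF that(1) Z Z that(2)] id by simp
  moreover have "f = zero_mor A Z X" if "X \<in> Obj A" "f \<in> mor A Z X" for X f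
    using Comp_Id[OF Z that(1) that(2)] comp_zero[OF Z Z that(1) that(2)] id by simp
  ultimately show ?thesis
    using Z by (auto simp: zero_object_def zero_mor_closed)
qed

end


section \<open>Compactness and finite sums of components\<close>

text \<open>
  Unlike the carrier of the library's \<open>sum_group\<close>, families are not required to be \<open>undefined\<close>
  outside \<open>I\<close>, so that they can be composed with morphisms without being restricted again.
\<close>

definition finite_families :: "('o, 'm, 'x) add_cat_scheme \<Rightarrow> 'i set \<Rightarrow> ('i \<Rightarrow> 'o) \<Rightarrow> 'o \<Rightarrow> ('i \<Rightarrow> 'm) set"
  where "finite_families A I M X =
    {x. (\<forall>i\<in>I. x i \<in> mor A X (M i)) \<and> finite {i \<in> I. x i \<noteq> zero_mor A X (M i)}}"

definition component_sum :: "('o, 'm, 'x) add_cat_scheme \<Rightarrow> 'i set \<Rightarrow> 'o \<Rightarrow> ('i \<Rightarrow> 'm) \<Rightarrow> 'o \<Rightarrow> ('i \<Rightarrow> 'm) \<Rightarrow> 'm"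
  where "component_sum A I C \<iota> X x = gfinprod (Hom A X C) (\<lambda>i. \<iota> i \<bullet>\<^bsub>A\<^esub> x i) I"

context preadditive_category
begin

context
  fixes I :: "'i set" and M C \<iota>
  assumes M: "\<And>i. i \<in> I \<Longrightarrow> M i \<in> Obj A" and C: "C \<in> Obj A"
    and \<iota>: "\<And>i. i \<in> I \<Longrightarrow> \<iota> i \<in> mor A (M i) C"
begin

lemma component_mor:
  assumes "X \<in> Obj A" "x \<in> finite_families A I M X" "i \<in> I"
  shows "\<iota> i \<bullet> x i \<in> mor A X C"
  using assms M C \<iota> by (auto simp: finite_families_def intro!: Comp_mor[where Y = "M i"])

lemma finite_components:
  assumes X: "X \<in> Obj A" and x: "x \<in> finite_families A I M X"
  shows "finite {i \<in> I. \<iota> i \<bullet> x i \<noteq> zero_mor A X C}"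
proof (rule finite_subset)
  show "{i \<in> I. \<iota> i \<bullet> x i \<noteq> zero_mor A X C} \<subseteq> {i \<in> I. x i \<noteq> zero_mor A X (M i)}"
    using X M C \<iota> comp_zero by auto
  show "finite {i \<in> I. x i \<noteq> zero_mor A X (M i)}"
    using x by (simp add: finite_families_def)
qed

lemma component_sum_closed:
  assumes "X \<in> Obj A" "x \<in> finite_families A I M X"
  shows "component_sum A I C \<iota> X x \<in> mor A X C"
proof -
  interpret comm_group "Hom A X C" using assms C by (intro Hom_group)
  show ?thesis
    unfolding component_sum_def using component_mor[OF assms] by (intro gfinprod_closed) auto
qed

lemma component_sum_cong:
  assumes "X \<in> Obj A" "y \<in> finite_families A I M X" "\<And>i. i \<in> I \<Longrightarrow> \<iota> i \<bullet> x i = \<iota> i \<bullet> y i"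
  shows "component_sum A I C \<iota> X x = component_sum A I C \<iota> X y"
proof -
  interpret comm_group "Hom A X C" using assms C by (intro Hom_group)
  show ?thesis
    unfolding component_sum_def
    using component_mor[OF assms(1,2)] assms(3) by (intro gfinprod_cong) (auto simp: simp_implies_def)
qed

lemma component_sum_add:
  assumes X: "X \<in> Obj A" and x: "x \<in> finite_families A I M X" and y: "y \<in> finite_families A I M X"
  shows "(\<lambda>i. x i \<otimes>\<^bsub>Hom A X (M i)\<^esub> y i) \<in> finite_families A I M X"
    and "component_sum A I C \<iota> X (\<lambda>i. x i \<otimes>\<^bsub>Hom A X (M i)\<^esub> y i) =
      component_sum A I C \<iota> X x \<otimes>\<^bsub>Hom A X C\<^esub> component_sum A I C \<iota> X y"
proof -
  interpret comm_group "Hom A X C" using X C by (intro Hom_group)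
  have mon: "monoid (Hom A X (M i))" if "i \<in> I" for i
    using X M[OF that] Hom_is_group group.is_monoid by blast
  have "finite {i \<in> I. x i \<otimes>\<^bsub>Hom A X (M i)\<^esub> y i \<noteq> zero_mor A X (M i)}"
  proof (rule finite_subset)
    show "{i \<in> I. x i \<otimes>\<^bsub>Hom A X (M i)\<^esub> y i \<noteq> zero_mor A X (M i)} \<subseteq>
      {i \<in> I. x i \<noteq> zero_mor A X (M i)} \<union> {i \<in> I. y i \<noteq> zero_mor A X (M i)}"
      using mon by (auto simp: monoid.l_one)
  qed (use x y in \<open>simp add: finite_families_def\<close>)
  then show fam: "(\<lambda>i. x i \<otimes>\<^bsub>Hom A X (M i)\<^esub> y i) \<in> finite_families A I M X"
    using x y mon by (auto simp: finite_families_def monoid.m_closed)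
  have "component_sum A I C \<iota> X (\<lambda>i. x i \<otimes>\<^bsub>Hom A X (M i)\<^esub> y i) =
      gfinprod (Hom A X C) (\<lambda>i. (\<iota> i \<bullet> x i) \<otimes>\<^bsub>Hom A X C\<^esub> (\<iota> i \<bullet> y i)) I"
    unfolding component_sum_def
  proof (rule gfinprod_cong)
    show "(\<lambda>i. \<iota> i \<bullet> (x i \<otimes>\<^bsub>Hom A X (M i)\<^esub> y i)) \<in> I \<rightarrow> mor A X C"
      using component_mor[OF X fam] by auto
    show "i \<in> I =simp=> \<iota> i \<bullet> (x i \<otimes>\<^bsub>Hom A X (M i)\<^esub> y i) =
        (\<iota> i \<bullet> x i) \<otimes>\<^bsub>Hom A X C\<^esub> (\<iota> i \<bullet> y i)" for i
      using X M C \<iota> x y by (auto simp: simp_implies_def finite_families_def intro!: Comp_add_right)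
  qed simp
  also have "\<dots> = component_sum A I C \<iota> X x \<otimes>\<^bsub>Hom A X C\<^esub> component_sum A I C \<iota> X y"
    unfolding component_sum_def
    by (rule gfinprod_distrib) (use finite_components component_mor X x y in auto)
  finally show "component_sum A I C \<iota> X (\<lambda>i. x i \<otimes>\<^bsub>Hom A X (M i)\<^esub> y i) =
      component_sum A I C \<iota> X x \<otimes>\<^bsub>Hom A X C\<^esub> component_sum A I C \<iota> X y" .
qed

lemma component_sum_comp:
  assumes X: "X \<in> Obj A" and Y: "Y \<in> Obj A" and x: "x \<in> finite_families A I M Y"
    and f: "f \<in> mor A X Y"
  shows "(\<lambda>i. x i \<bullet> f) \<in> finite_families A I M X"
    and "component_sum A I C \<iota> Y x \<bullet> f = component_sum A I C \<iota> X (\<lambda>i. x i \<bullet> f)"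
proof -
  have "finite {i \<in> I. x i \<bullet> f \<noteq> zero_mor A X (M i)}"
  proof (rule finite_subset)
    show "{i \<in> I. x i \<bullet> f \<noteq> zero_mor A X (M i)} \<subseteq> {i \<in> I. x i \<noteq> zero_mor A Y (M i)}"
      using X Y f M by (auto simp: zero_comp)
  qed (use x in \<open>simp add: finite_families_def\<close>)
  then show fam: "(\<lambda>i. x i \<bullet> f) \<in> finite_families A I M X"
    using x f X Y M by (auto simp: finite_families_def intro!: Comp_mor[where Y = Y])
  interpret comm_group "Hom A X C" using X C by (intro Hom_group)
  have "component_sum A I C \<iota> Y x \<bullet> f = gfinprod (Hom A X C) (\<lambda>i. (\<iota> i \<bullet> x i) \<bullet> f) I"
    unfolding component_sum_def
    by (rule hom_gfinprod[OF Hom_group Hom_group comp_right_hom])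
      (use X Y C f component_mor[OF Y x] finite_components[OF Y x] in auto)
  also have "\<dots> = gfinprod (Hom A X C) (\<lambda>i. \<iota> i \<bullet> (x i \<bullet> f)) I"
  proof (rule gfinprod_cong)
    show "(\<lambda>i. (\<iota> i \<bullet> x i) \<bullet> f) \<in> I \<rightarrow> mor A X C"
      using Comp_mor[OF X Y C f component_mor[OF Y x]] by blast
  next
    show "i \<in> I =simp=> (\<iota> i \<bullet> x i) \<bullet> f = \<iota> i \<bullet> (x i \<bullet> f)" for i
      using Comp_assoc[OF X Y M[of i] C f _ \<iota>[of i]] x by (auto simp: simp_implies_def finite_families_def)
  qed simp
  finally show "component_sum A I C \<iota> Y x \<bullet> f = component_sum A I C \<iota> X (\<lambda>i. x i \<bullet> f)"
    by (simp add: component_sum_def)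
qed

lemma comp_component_sum:
  assumes X: "X \<in> Obj A" and D: "D \<in> Obj A" and x: "x \<in> finite_families A I M X"
    and g: "g \<in> mor A C D"
  shows "g \<bullet> component_sum A I C \<iota> X x = component_sum A I D (\<lambda>i. g \<bullet> \<iota> i) X x"
proof -
  interpret comm_group "Hom A X D" using X D by (intro Hom_group)
  have "g \<bullet> component_sum A I C \<iota> X x = gfinprod (Hom A X D) (\<lambda>i. g \<bullet> (\<iota> i \<bullet> x i)) I"
    unfolding component_sum_def
    by (rule hom_gfinprod[OF Hom_group Hom_group comp_left_hom])
      (use X D C g component_mor[OF X x] finite_components[OF X x] in auto)
  also have "\<dots> = gfinprod (Hom A X D) (\<lambda>i. (g \<bullet> \<iota> i) \<bullet> x i) I"
  proof (rule gfinprod_cong)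
    show "(\<lambda>i. g \<bullet> (\<iota> i \<bullet> x i)) \<in> I \<rightarrow> mor A X D"
      using Comp_mor[OF X C D component_mor[OF X x] g] by blast
  next
    show "i \<in> I =simp=> g \<bullet> (\<iota> i \<bullet> x i) = (g \<bullet> \<iota> i) \<bullet> x i" for i
      using Comp_assoc[OF X M[of i] C D _ \<iota>[of i] g] x by (auto simp: simp_implies_def finite_families_def)
  qed simp
  finally show ?thesis
    by (simp add: component_sum_def)
qed

end

lemma coproduct_universal:
  assumes "is_coproduct A I M C \<iota>" "N \<in> Obj A" "\<And>i. i \<in> I \<Longrightarrow> g i \<in> mor A (M i) N"
  obtains h where "h \<in> mor A C N" "\<forall>i\<in>I. h \<bullet> \<iota> i = g i"
    and "\<forall>h'. h' \<in> mor A C N \<longrightarrow> (\<forall>i\<in>I. h' \<bullet> \<iota> i = g i) \<longrightarrow> h' = h"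
proof -
  have "\<exists>!h. h \<in> mor A C N \<and> (\<forall>i\<in>I. h \<bullet> \<iota> i = g i)"
    using assms by (simp add: is_coproduct_def)
  then show thesis
    using that by (elim ex1E conjE) blast
qed

text \<open>
  The projection \<open>p\<close> is induced by the identity on the summand \<open>M j\<close> and by zero on all the others,
  whence it picks the \<open>j\<close>-th entry out of a component sum.
\<close>

lemma coproduct_projection:
  assumes M: "\<And>i. i \<in> I \<Longrightarrow> M i \<in> Obj A" and cop: "is_coproduct A I M C \<iota>" and j: "j \<in> I"
  obtains p where "p \<in> mor A C (M j)"
    and "\<And>X x. X \<in> Obj A \<Longrightarrow> x \<in> finite_families A I M X \<Longrightarrow> p \<bullet> component_sum A I C \<iota> X x = x j"
proof -
  have C: "C \<in> Obj A" and \<iota>: "\<And>i. i \<in> I \<Longrightarrow> \<iota> i \<in> mor A (M i) C"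
    using cop by (auto simp: is_coproduct_def)
  define g where "g i = (if i = j then Ide A (M j) else zero_mor A (M i) (M j))" for i
  have "\<And>i. i \<in> I \<Longrightarrow> g i \<in> mor A (M i) (M j)"
    using M j by (auto simp: g_def Id_mor zero_mor_closed)
  then obtain p where p: "p \<in> mor A C (M j)" and pi: "\<And>i. i \<in> I \<Longrightarrow> p \<bullet> \<iota> i = g i"
    using coproduct_universal[OF cop M[OF j]] by metis
  have "p \<bullet> component_sum A I C \<iota> X x = x j"
    if X: "X \<in> Obj A" and x: "x \<in> finite_families A I M X" for X x
  proof -
    have xm: "x i \<in> mor A X (M i)" if "i \<in> I" for i
      using x that by (simp add: finite_families_def)
    interpret comm_group "Hom A X (M j)" using X M[OF j] by (intro Hom_group)
    have eq: "(p \<bullet> \<iota> i) \<bullet> x i = (if i = j then x j else zero_mor A X (M j))" if "i \<in> I" for i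
      using X M j that xm[OF that] by (auto simp: pi g_def intro: Id_Comp zero_comp)
    have "p \<bullet> component_sum A I C \<iota> X x = component_sum A I (M j) (\<lambda>i. p \<bullet> \<iota> i) X x"
      using comp_component_sum[OF M C \<iota> X M[OF j] x p] .
    also have "\<dots> = (p \<bullet> \<iota> j) \<bullet> x j"
      unfolding component_sum_def
      by (rule gfinprod_delta) (use j eq xm zero_mor_closed[OF X M[OF j]] in auto)
    also have "\<dots> = x j"
      using eq[OF j] by simp
    finally show ?thesis .
  qed
  then show thesis
    using p that by blast
qed

text \<open>
  By the projections onto the summands, the canonical map from the direct sum is always injective;
  being an isomorphism thus amounts to being surjective.
\<close>

lemma compact_object_iff_component_sums:
  "compact_object sml A X \<longleftrightarrow> X \<in> Obj A \<and>
    (\<forall>I M C \<iota>. sml I \<and> (\<forall>i\<in>I. M i \<in> Obj A) \<and> is_coproduct A I M C \<iota> \<longrightarrow>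
      mor A X C \<subseteq> component_sum A I C \<iota> X ` finite_families A I M X)"
proof -
  have eq: "(\<lambda>x. gfinprod (Hom A X C) (\<lambda>i. \<iota> i \<bullet> x i) I)
        \<in> iso (sum_group I (\<lambda>i. Hom A X (M i))) (Hom A X C) \<longleftrightarrow>
      mor A X C \<subseteq> component_sum A I C \<iota> X ` finite_families A I M X" (is "?\<phi> \<in> iso ?S _ \<longleftrightarrow> _")
    if X: "X \<in> Obj A" and M: "\<forall>i\<in>I. M i \<in> Obj A" and cop: "is_coproduct A I M C \<iota>"
    for I :: "'u set" and M C \<iota>
  proof -
    have M: "\<And>i. i \<in> I \<Longrightarrow> M i \<in> Obj A" using M by blast
    have C: "C \<in> Obj A" and \<iota>: "\<And>i. i \<in> I \<Longrightarrow> \<iota> i \<in> mor A (M i) C"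
      using cop by (auto simp: is_coproduct_def)
    interpret comm_group "Hom A X C" using X C by (intro Hom_group)
    have S: "carrier ?S = extensional I \<inter> finite_families A I M X"
      using X M by (subst carrier_sum_group) (auto simp: Hom_is_group finite_families_def PiE_def)
    have restr: "restrict x I \<in> carrier ?S" "component_sum A I C \<iota> X (restrict x I) = component_sum A I C \<iota> X x"
      if "x \<in> finite_families A I M X" for x
    proof -
      show "restrict x I \<in> carrier ?S"
        using that unfolding S by (auto simp: finite_families_def cong: conj_cong)
      show "component_sum A I C \<iota> X (restrict x I) = component_sum A I C \<iota> X x"
        by (rule component_sum_cong[OF M C \<iota> X that]) auto
    qed
    have \<phi>: "?\<phi> = component_sum A I C \<iota> X"
      by (auto simp: component_sum_def)
    have hom: "component_sum A I C \<iota> X \<in> hom ?S (Hom A X C)"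
      unfolding \<phi>[symmetric]
      using X M C \<iota> by (intro hom_group_sum) (auto intro: comp_left_hom Hom_is_group)
    have inj: "inj_on (component_sum A I C \<iota> X) (carrier ?S)"
    proof (rule inj_onI)
      fix x y
      assume x: "x \<in> carrier ?S" and y: "y \<in> carrier ?S"
        and eq: "component_sum A I C \<iota> X x = component_sum A I C \<iota> X y"
      have "x j = y j" if j: "j \<in> I" for j
      proof -
        obtain p where "\<And>X x. X \<in> Obj A \<Longrightarrow> x \<in> finite_families A I M X \<Longrightarrow>
            p \<bullet> component_sum A I C \<iota> X x = x j"
          using coproduct_projection[OF M cop j] by blast
        then show ?thesis
          using x y X unfolding S by (metis eq IntD2)
      qed
      then show "x = y"
        using x y unfolding S by (auto intro: extensionalityI)
    qed
    have "component_sum A I C \<iota> X ` carrier ?S = component_sum A I C \<iota> X ` finite_families A I M X"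
    proof
      show "component_sum A I C \<iota> X ` finite_families A I M X \<subseteq> component_sum A I C \<iota> X ` carrier ?S"
      proof
        fix f assume "f \<in> component_sum A I C \<iota> X ` finite_families A I M X"
        then obtain x where "x \<in> finite_families A I M X" "f = component_sum A I C \<iota> X x" by blast
        then show "f \<in> component_sum A I C \<iota> X ` carrier ?S"
          by (intro image_eqI[of _ _ "restrict x I"]) (simp_all only: restr)
      qed
    qed (auto simp: S)
    moreover have "component_sum A I C \<iota> X ` finite_families A I M X \<subseteq> mor A X C"
      using component_sum_closed[where I = I and M = M, OF M C \<iota> X] by (intro image_subsetI) simp
    ultimately have "component_sum A I C \<iota> X \<in> iso ?S (Hom A X C) \<longleftrightarrow>
        mor A X C \<subseteq> component_sum A I C \<iota> X ` finite_families A I M X"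
      using hom inj by (auto simp: iso_def bij_betw_def)
    then show ?thesis
      by (subst \<phi>)
  qed
  show ?thesis
    unfolding compact_object_def
    by (intro conj_cong[OF refl] iff_allI imp_cong[OF refl] eq) simp_all
qed

end

section \<open>Coproducts along equivalences\<close>

context preadditive_category
begin

lemma is_coproduct_cong:
  assumes "\<And>i. i \<in> I \<Longrightarrow> \<iota> i = \<iota>' i"
  shows "is_coproduct A I M C \<iota> \<longleftrightarrow> is_coproduct A I M C \<iota>'"
  using assms by (simp add: is_coproduct_def)

lemma comp_inverse_left:
  assumes "X \<in> Obj A" "Y \<in> Obj A" "Z \<in> Obj A" "f \<in> mor A X Y" "g \<in> mor A Y Z" "g' \<in> mor A Z Y"
    and "g' \<bullet> g = Ide A Y"
  shows "g' \<bullet> (g \<bullet> f) = f"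
  using Comp_assoc[of X Y Z Y f g g'] Id_Comp[of X Y f] assms by simp

lemma comp_inverse_right:
  assumes "X \<in> Obj A" "Y \<in> Obj A" "Z \<in> Obj A" "f \<in> mor A Y Z" "g \<in> mor A X Y" "g' \<in> mor A Y X"
    and "g \<bullet> g' = Ide A Y"
  shows "(f \<bullet> g) \<bullet> g' = f"
  using Comp_assoc[of Y X Y Z g' g f] Comp_Id[of Y Z f] assms by simp

text \<open>
  The equation \<open>k \<bullet> (\<delta>' \<bullet> (\<iota> i \<bullet> \<alpha> i)) = g i\<close> is equivalent to \<open>(k \<bullet> \<delta>') \<bullet> \<iota> i = g i \<bullet> \<alpha>' i\<close>, where
  \<open>\<alpha>' i\<close> is inverse to \<open>\<alpha> i\<close>, and \<open>k \<mapsto> k \<bullet> \<delta>'\<close> is a bijection from the morphisms out of \<open>D\<close> to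
  those out of \<open>C\<close>.
\<close>

lemma coproduct_transport:
  assumes cop: "is_coproduct A I M C \<iota>"
    and M: "\<And>i. i \<in> I \<Longrightarrow> M i \<in> Obj A" and N: "\<And>i. i \<in> I \<Longrightarrow> N i \<in> Obj A" and D: "D \<in> Obj A"
    and \<alpha>: "\<And>i. i \<in> I \<Longrightarrow> isomorphism A (N i) (M i) (\<alpha> i)"
    and \<delta>: "\<delta> \<in> mor A D C" and \<delta>': "\<delta>' \<in> mor A C D"
    and inv1: "\<delta>' \<bullet> \<delta> = Ide A D" and inv2: "\<delta> \<bullet> \<delta>' = Ide A C"
  shows "is_coproduct A I N D (\<lambda>i. \<delta>' \<bullet> (\<iota> i \<bullet> \<alpha> i))"
proof -
  have C: "C \<in> Obj A" and \<iota>: "\<And>i. i \<in> I \<Longrightarrow> \<iota> i \<in> mor A (M i) C"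
    using cop by (auto simp: is_coproduct_def)
  have \<alpha>m: "\<And>i. i \<in> I \<Longrightarrow> \<alpha> i \<in> mor A (N i) (M i)"
    using \<alpha> by (auto simp: isomorphism_def)
  obtain \<alpha>' where \<alpha>': "\<And>i. i \<in> I \<Longrightarrow> \<alpha>' i \<in> mor A (M i) (N i)"
    and \<alpha>1: "\<And>i. i \<in> I \<Longrightarrow> \<alpha>' i \<bullet> \<alpha> i = Ide A (N i)"
    and \<alpha>2: "\<And>i. i \<in> I \<Longrightarrow> \<alpha> i \<bullet> \<alpha>' i = Ide A (M i)"
    using \<alpha> unfolding isomorphism_def by metis
  have \<iota>\<alpha>: "\<iota> i \<bullet> \<alpha> i \<in> mor A (N i) C" if "i \<in> I" for i
    using Comp_mor[OF N M C \<alpha>m \<iota>] that by blast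
  have comp: "k \<bullet> (\<delta>' \<bullet> (\<iota> i \<bullet> \<alpha> i)) = g i \<longleftrightarrow> (k \<bullet> \<delta>') \<bullet> \<iota> i = g i \<bullet> \<alpha>' i"
    if i: "i \<in> I" and L: "L \<in> Obj A" and k: "k \<in> mor A D L" and g: "g i \<in> mor A (N i) L" for i k L g
  proof -
    have k\<delta>: "k \<bullet> \<delta>' \<in> mor A C L"
      using Comp_mor[OF C D L \<delta>' k] .
    have "k \<bullet> (\<delta>' \<bullet> (\<iota> i \<bullet> \<alpha> i)) = (k \<bullet> \<delta>') \<bullet> (\<iota> i \<bullet> \<alpha> i)"
      using Comp_assoc[OF N[OF i] C D L \<iota>\<alpha>[OF i] \<delta>' k] by simp
    also have "\<dots> = ((k \<bullet> \<delta>') \<bullet> \<iota> i) \<bullet> \<alpha> i"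
      using Comp_assoc[OF N[OF i] M[OF i] C L \<alpha>m[OF i] \<iota>[OF i] k\<delta>] by simp
    finally have eq: "k \<bullet> (\<delta>' \<bullet> (\<iota> i \<bullet> \<alpha> i)) = ((k \<bullet> \<delta>') \<bullet> \<iota> i) \<bullet> \<alpha> i" .
    have "(k \<bullet> \<delta>') \<bullet> \<iota> i \<in> mor A (M i) L"
      using Comp_mor[OF M[OF i] C L \<iota>[OF i] k\<delta>] .
    then have "(((k \<bullet> \<delta>') \<bullet> \<iota> i) \<bullet> \<alpha> i) \<bullet> \<alpha>' i = (k \<bullet> \<delta>') \<bullet> \<iota> i"
      using comp_inverse_right[OF N[OF i] M[OF i] L _ \<alpha>m[OF i] \<alpha>'[OF i] \<alpha>2[OF i]] by simp
    moreover have "(g i \<bullet> \<alpha>' i) \<bullet> \<alpha> i = g i"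
      using comp_inverse_right[OF M[OF i] N[OF i] L g \<alpha>'[OF i] \<alpha>m[OF i] \<alpha>1[OF i]] .
    ultimately show ?thesis
      unfolding eq by metis
  qed
  have "\<exists>!k. k \<in> mor A D L \<and> (\<forall>i\<in>I. k \<bullet> (\<delta>' \<bullet> (\<iota> i \<bullet> \<alpha> i)) = g i)"
    if L: "L \<in> Obj A" and g: "\<forall>i\<in>I. g i \<in> mor A (N i) L" for L g
  proof -
    have "g i \<bullet> \<alpha>' i \<in> mor A (M i) L" if "i \<in> I" for i
      using g Comp_mor[OF M[OF that] N[OF that] L \<alpha>'[OF that]] that by blast
    then obtain h where h: "h \<in> mor A C L" "\<forall>i\<in>I. h \<bullet> \<iota> i = g i \<bullet> \<alpha>' i"
      and uniq: "\<forall>h'. h' \<in> mor A C L \<longrightarrow> (\<forall>i\<in>I. h' \<bullet> \<iota> i = g i \<bullet> \<alpha>' i) \<longrightarrow> h' = h"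
      by (rule coproduct_universal[OF cop L])
    show ?thesis
    proof (intro ex1I[of _ "h \<bullet> \<delta>"] conjI ballI)
      show h\<delta>: "h \<bullet> \<delta> \<in> mor A D L"
        using Comp_mor[OF D C L \<delta> h(1)] .
      have "(h \<bullet> \<delta>) \<bullet> \<delta>' = h"
        using comp_inverse_right[OF D C L h(1) \<delta> \<delta>' inv2] .
      then show "(h \<bullet> \<delta>) \<bullet> (\<delta>' \<bullet> (\<iota> i \<bullet> \<alpha> i)) = g i" if "i \<in> I" for i
        using comp[of i L "h \<bullet> \<delta>" g] that L h\<delta> g h(2) by simp
    next
      fix k assume k: "k \<in> mor A D L \<and> (\<forall>i\<in>I. k \<bullet> (\<delta>' \<bullet> (\<iota> i \<bullet> \<alpha> i)) = g i)"
      then have "\<forall>i\<in>I. (k \<bullet> \<delta>') \<bullet> \<iota> i = g i \<bullet> \<alpha>' i"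
        using comp[of _ L k g] L g by blast
      then have "k \<bullet> \<delta>' = h"
        using uniq k Comp_mor[OF C D L \<delta>'] by blast
      then show "k = h \<bullet> \<delta>"
        using comp_inverse_right[OF C D L _ \<delta>' \<delta> inv1] k by metis
    qed
  qed
  moreover have "\<delta>' \<bullet> (\<iota> i \<bullet> \<alpha> i) \<in> mor A (N i) D" if "i \<in> I" for i
    using Comp_mor[OF N[OF that] C D \<iota>\<alpha>[OF that] \<delta>'] .
  ultimately show ?thesis
    unfolding is_coproduct_def using D by blast
qed

end

context triangulated_category
begin

lemma SusM_hom: "X \<in> Obj T \<Longrightarrow> Y \<in> Obj T \<Longrightarrow> SusM T \<in> hom (Hom T X Y) (Hom T (Sus T X) (Sus T Y))"
  using SusM_fully_faithful by (simp add: iso_def)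

lemma SusM_mor: "X \<in> Obj T \<Longrightarrow> Y \<in> Obj T \<Longrightarrow> f \<in> mor T X Y \<Longrightarrow> SusM T f \<in> mor T (Sus T X) (Sus T Y)"
  using SusM_hom hom_in_carrier by fast

lemma SusM_inject:
  "X \<in> Obj T \<Longrightarrow> Y \<in> Obj T \<Longrightarrow> f \<in> mor T X Y \<Longrightarrow> g \<in> mor T X Y \<Longrightarrow> SusM T f = SusM T g \<Longrightarrow> f = g"
  using SusM_fully_faithful[of X Y] by (auto simp: iso_def bij_betw_def dest: inj_onD)

lemma SusM_surj:
  assumes "X \<in> Obj T" "Y \<in> Obj T" "g \<in> mor T (Sus T X) (Sus T Y)"
  obtains f where "f \<in> mor T X Y" "SusM T f = g"
proof -
  have "g \<in> SusM T ` mor T X Y"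
    using SusM_fully_faithful[of X Y] assms by (simp add: iso_def bij_betw_def)
  then show thesis
    using that by blast
qed

lemma SusM_zero:
  assumes "X \<in> Obj T" "Y \<in> Obj T"
  shows "SusM T (zero_mor T X Y) = zero_mor T (Sus T X) (Sus T Y)"
  using hom_one[OF SusM_hom] assms by (simp add: Hom_is_group Sus_Obj)

text \<open>
  A fully faithful functor reflects universal properties.
\<close>

lemma Sus_reflects_coproduct:
  assumes cop: "is_coproduct T I (\<lambda>i. Sus T (N i)) (Sus T D) (\<lambda>i. SusM T (j i))"
    and N: "\<And>i. i \<in> I \<Longrightarrow> N i \<in> Obj T" and D: "D \<in> Obj T"
    and j: "\<And>i. i \<in> I \<Longrightarrow> j i \<in> mor T (N i) D"
  shows "is_coproduct T I N D j"
proof -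
  have "\<exists>!k. k \<in> mor T D L \<and> (\<forall>i\<in>I. k \<bullet> j i = g i)"
    if L: "L \<in> Obj T" and g: "\<forall>i\<in>I. g i \<in> mor T (N i) L" for L g
  proof -
    have comp: "k \<bullet> j i = g i \<longleftrightarrow> SusM T k \<bullet> SusM T (j i) = SusM T (g i)"
      if i: "i \<in> I" and k: "k \<in> mor T D L" for i k
      using SusM_Comp[OF N[OF i] D L j[OF i] k]
        SusM_inject[OF N[OF i] L Comp_mor[OF N[OF i] D L j[OF i] k]] g i by metis
    have "\<And>i. i \<in> I \<Longrightarrow> SusM T (g i) \<in> mor T (Sus T (N i)) (Sus T L)"
      using g N L SusM_mor by blast
    then obtain h where h: "h \<in> mor T (Sus T D) (Sus T L)"
      "\<forall>i\<in>I. h \<bullet> SusM T (j i) = SusM T (g i)"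
      and uniq: "\<forall>h'. h' \<in> mor T (Sus T D) (Sus T L) \<longrightarrow>
        (\<forall>i\<in>I. h' \<bullet> SusM T (j i) = SusM T (g i)) \<longrightarrow> h' = h"
      by (rule coproduct_universal[OF cop Sus_Obj[OF L]])
    obtain k where k: "k \<in> mor T D L" "SusM T k = h"
      using SusM_surj[OF D L h(1)] .
    show ?thesis
    proof (intro ex1I[of _ k] conjI ballI)
      show "k \<bullet> j i = g i" if "i \<in> I" for i
        using comp[OF that k(1)] k(2) h(2) that by simp
    next
      fix k' assume k': "k' \<in> mor T D L \<and> (\<forall>i\<in>I. k' \<bullet> j i = g i)"
      then have "SusM T k' = h"
        using uniq SusM_mor[OF D L] comp by blast
      then show "k' = k"
        using SusM_inject[OF D L] k k' by blast
    qed (rule k(1))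
  qed
  then show ?thesis
    unfolding is_coproduct_def using D j by blast
qed


section \<open>Closure of the compact objects\<close>

text \<open>
  The suspension is essentially surjective, so the summands \<open>M i\<close> and their coproduct \<open>C\<close> can be
  desuspended to \<open>N i\<close> and \<open>D\<close>, and \<open>D\<close> is a coproduct of the \<open>N i\<close>. A morphism \<open>\<Sigma>X \<rightarrow> C\<close> then
  comes from a morphism \<open>X \<rightarrow> D\<close>, which is a finite sum of components as \<open>X\<close> is compact;
  suspending that sum expresses the original morphism as a finite sum of components.
\<close>

lemma compact_Sus:
  assumes X: "compact_object sml T X"
  shows "compact_object sml T (Sus T X)"
proof -
  have XO: "X \<in> Obj T" using X by (simp add: compact_object_def)
  have "f \<in> component_sum T I C \<iota> (Sus T X) ` finite_families T I M (Sus T X)"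
    if I: "sml I" and M: "\<forall>i\<in>I. M i \<in> Obj T" and cop: "is_coproduct T I M C \<iota>"
      and f: "f \<in> mor T (Sus T X) C" for I M C \<iota> f
  proof -
    have M: "\<And>i. i \<in> I \<Longrightarrow> M i \<in> Obj T" using M by blast
    have C: "C \<in> Obj T" and \<iota>: "\<And>i. i \<in> I \<Longrightarrow> \<iota> i \<in> mor T (M i) C"
      using cop by (auto simp: is_coproduct_def)
    obtain N \<alpha> where N: "\<And>i. i \<in> I \<Longrightarrow> N i \<in> Obj T"
      and \<alpha>: "\<And>i. i \<in> I \<Longrightarrow> isomorphism T (Sus T (N i)) (M i) (\<alpha> i)"
    proof -
      have "\<forall>i\<in>I. \<exists>N\<alpha>. fst N\<alpha> \<in> Obj T \<and> isomorphism T (Sus T (fst N\<alpha>)) (M i) (snd N\<alpha>)"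
        using Sus_essentially_surjective M unfolding isomorphic_def by fastforce
      then obtain F where "\<forall>i\<in>I. fst (F i) \<in> Obj T \<and> isomorphism T (Sus T (fst (F i))) (M i) (snd (F i))"
        by (rule bchoice[THEN exE])
      then show thesis
        using that[of "\<lambda>i. fst (F i)" "\<lambda>i. snd (F i)"] by blast
    qed
    have \<alpha>m: "\<And>i. i \<in> I \<Longrightarrow> \<alpha> i \<in> mor T (Sus T (N i)) (M i)"
      using \<alpha> by (auto simp: isomorphism_def)
    obtain D \<delta> \<delta>' where D: "D \<in> Obj T" and \<delta>: "\<delta> \<in> mor T (Sus T D) C" and \<delta>': "\<delta>' \<in> mor T C (Sus T D)"
      and inv: "\<delta>' \<bullet> \<delta> = Ide T (Sus T D)" "\<delta> \<bullet> \<delta>' = Ide T C"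
      using Sus_essentially_surjective[OF C] unfolding isomorphic_def isomorphism_def by metis
    let ?\<kappa> = "\<lambda>i. \<delta>' \<bullet> (\<iota> i \<bullet> \<alpha> i)"
    have SN: "\<And>i. i \<in> I \<Longrightarrow> Sus T (N i) \<in> Obj T" and SD: "Sus T D \<in> Obj T" and SX: "Sus T X \<in> Obj T"
      using N D XO by (auto intro: Sus_Obj)
    have cop': "is_coproduct T I (\<lambda>i. Sus T (N i)) (Sus T D) ?\<kappa>"
      by (rule coproduct_transport[OF cop M SN SD \<alpha> \<delta> \<delta>' inv])
    have "\<forall>i\<in>I. \<exists>k. k \<in> mor T (N i) D \<and> SusM T k = ?\<kappa> i"
    proof
      fix i assume i: "i \<in> I"
      then have "?\<kappa> i \<in> mor T (Sus T (N i)) (Sus T D)"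
        using cop' unfolding is_coproduct_def by blast
      then show "\<exists>k. k \<in> mor T (N i) D \<and> SusM T k = ?\<kappa> i"
        using SusM_surj[OF N[OF i] D] by blast
    qed
    then obtain j where "\<forall>i\<in>I. j i \<in> mor T (N i) D \<and> SusM T (j i) = ?\<kappa> i"
      by (rule bchoice[THEN exE])
    then have j: "\<And>i. i \<in> I \<Longrightarrow> j i \<in> mor T (N i) D" and Sj: "\<And>i. i \<in> I \<Longrightarrow> SusM T (j i) = ?\<kappa> i"
      by blast+
    have "is_coproduct T I (\<lambda>i. Sus T (N i)) (Sus T D) (\<lambda>i. SusM T (j i))"
      by (rule is_coproduct_cong[THEN iffD2, OF Sj cop'])
    then have copj: "is_coproduct T I N D j"
      by (rule Sus_reflects_coproduct[OF _ N D j])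
    have "\<delta>' \<bullet> f \<in> mor T (Sus T X) (Sus T D)"
      using Comp_mor[OF SX C SD f \<delta>'] .
    then obtain f' where f': "f' \<in> mor T X D" "SusM T f' = \<delta>' \<bullet> f"
      using SusM_surj[OF XO D] by blast
    obtain x where x: "x \<in> finite_families T I N X" and fx: "f' = component_sum T I D j X x"
      using X I N copj f'(1) unfolding compact_object_iff_component_sums by blast
    have xm: "\<And>i. i \<in> I \<Longrightarrow> x i \<in> mor T X (N i)" and xfin: "finite {i \<in> I. x i \<noteq> zero_mor T X (N i)}"
      using x by (auto simp: finite_families_def)
    define y where "y i = \<alpha> i \<bullet> SusM T (x i)" for i
    have ym: "y i \<in> mor T (Sus T X) (M i)" if "i \<in> I" for i
      unfolding y_def using Comp_mor[OF SX SN M SusM_mor[OF XO N xm] \<alpha>m] that by blast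
    have y: "y \<in> finite_families T I M (Sus T X)"
    proof -
      have "{i \<in> I. y i \<noteq> zero_mor T (Sus T X) (M i)} \<subseteq> {i \<in> I. x i \<noteq> zero_mor T X (N i)}"
        using SX SN M \<alpha>m XO N by (auto simp: y_def SusM_zero comp_zero)
      then show ?thesis
        using ym xfin finite_subset by (auto simp: finite_families_def)
    qed
    interpret comm_group "Hom T (Sus T X) C" using SX C by (intro Hom_group)
    have summand: "\<delta> \<bullet> SusM T (j i \<bullet> x i) = \<iota> i \<bullet> y i" if i: "i \<in> I" for i
    proof -
      have Sx: "SusM T (x i) \<in> mor T (Sus T X) (Sus T (N i))"
        using SusM_mor[OF XO N[OF i] xm[OF i]] .
      have \<iota>y: "\<iota> i \<bullet> y i \<in> mor T (Sus T X) C"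
        using Comp_mor[OF SX M[OF i] C ym[OF i] \<iota>[OF i]] .
      have "SusM T (j i \<bullet> x i) = (\<delta>' \<bullet> (\<iota> i \<bullet> \<alpha> i)) \<bullet> SusM T (x i)"
        using SusM_Comp[OF XO N[OF i] D xm[OF i] j[OF i]] Sj[OF i] by simp
      also have "\<dots> = \<delta>' \<bullet> ((\<iota> i \<bullet> \<alpha> i) \<bullet> SusM T (x i))"
        using Comp_assoc[OF SX SN[OF i] C SD Sx Comp_mor[OF SN[OF i] M[OF i] C \<alpha>m[OF i] \<iota>[OF i]] \<delta>'] .
      also have "\<dots> = \<delta>' \<bullet> (\<iota> i \<bullet> y i)"
        unfolding y_def using Comp_assoc[OF SX SN[OF i] M[OF i] C Sx \<alpha>m[OF i] \<iota>[OF i]] by simp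
      finally show ?thesis
        using comp_inverse_left[OF SX C SD \<iota>y \<delta>' \<delta> inv(2)] by simp
    qed
    have hom: "(\<lambda>g. \<delta> \<bullet> SusM T g) \<in> hom (Hom T X D) (Hom T (Sus T X) C)"
      using Group.hom_compose[OF SusM_hom[OF XO D] comp_left_hom[OF SX SD C \<delta>]] by (simp add: comp_def)
    have "f = \<delta> \<bullet> SusM T f'"
      using comp_inverse_left[OF SX C SD f \<delta>' \<delta> inv(2)] f'(2) by simp
    also have "\<dots> = gfinprod (Hom T (Sus T X) C) (\<lambda>i. \<delta> \<bullet> SusM T (j i \<bullet> x i)) I"
      unfolding fx component_sum_def
      using hom_gfinprod[OF Hom_group[OF XO D] Hom_group[OF SX C] hom
          component_mor[OF N D j XO x] finite_components[OF N D j XO x]] .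
    also have "\<dots> = component_sum T I C \<iota> (Sus T X) y"
      unfolding component_sum_def
      by (rule gfinprod_cong)
        (use summand component_mor[OF M C \<iota> SX y] in \<open>auto simp: simp_implies_def\<close>)
    finally show ?thesis
      using y by blast
  qed
  then show ?thesis
    unfolding compact_object_iff_component_sums using XO Sus_Obj by blast
qed

lemma zero_object_Sus: "zero_object T Z \<Longrightarrow> zero_object T (Sus T Z)"
proof (rule zero_objectI)
  assume Z: "zero_object T Z"
  then have O: "Z \<in> Obj T" and "Ide T Z = zero_mor T Z Z"
    using Id_mor[of Z] by (auto simp: zero_object_def)
  then show "Ide T (Sus T Z) = zero_mor T (Sus T Z) (Sus T Z)"
    using SusM_Id[OF O] SusM_zero[OF O O] by simp
  show "Sus T Z \<in> Obj T" using O by (rule Sus_Obj)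
qed

text \<open>
  Filling in the morphism from the triangle \<open>X = X \<rightarrow> 0 \<rightarrow> \<Sigma>X\<close> to the given one that consists of the
  identity and \<open>u\<close> shows that \<open>v \<bullet> u\<close> factors through a zero object.
\<close>

lemma Tri_comp_zero:
  assumes tri: "Tri T X Y Z u v w"
  shows "v \<bullet> u = zero_mor T X Z"
proof -
  have O: "X \<in> Obj T" "Y \<in> Obj T" "Z \<in> Obj T" and u: "u \<in> mor T X Y"
    using Tri_candidate[OF tri] by (auto simp: candidate_triangle_def)
  obtain O0 where Z0: "zero_object T O0" using ex_zero_object by blast
  then have O0: "O0 \<in> Obj T" by (simp add: zero_object_def)
  obtain h where "h \<in> mor T O0 Z" "h \<bullet> zero_mor T X O0 = v \<bullet> u"
    using Tri_fill[OF Tri_Id[OF O(1) Z0] tri Id_mor[OF O(1)] u] by blast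
  then show ?thesis
    using comp_zero[OF O(1) O0 O(3)] by simp
qed

text \<open>
  The pair of \<open>0 : X \<rightarrow> 0\<close> and \<open>g : Y \<rightarrow> M\<close> extends to a morphism into the triangle
  \<open>0 \<rightarrow> M = M \<rightarrow> \<Sigma>0\<close>, which is distinguished as it rotates to the trivial triangle on \<open>M\<close>; the third
  component of that morphism is the desired factorization.
\<close>

lemma Tri_weak_cokernel:
  assumes tri: "Tri T X Y Z u v w" and M: "M \<in> Obj T" and g: "g \<in> mor T Y M"
    and gu: "g \<bullet> u = zero_mor T X M"
  obtains z where "z \<in> mor T Z M" "z \<bullet> v = g"
proof -
  have O: "X \<in> Obj T" "Y \<in> Obj T" "Z \<in> Obj T"
    using Tri_candidate[OF tri] by (auto simp: candidate_triangle_def)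
  obtain O0 where Z0: "zero_object T O0" using ex_zero_object by blast
  then have O0: "O0 \<in> Obj T" by (simp add: zero_object_def)
  have SZ0: "zero_object T (Sus T O0)" using zero_object_Sus[OF Z0] .
  then have SO0: "Sus T O0 \<in> Obj T" by (simp add: zero_object_def)
  interpret S: group "Hom T (Sus T O0) (Sus T M)" using O0 M by (intro Hom_is_group Sus_Obj)
  have cand: "candidate_triangle T O0 M M (zero_mor T O0 M) (Ide T M) (zero_mor T M (Sus T O0))"
    using O0 M SO0 by (simp add: candidate_triangle_def zero_mor_closed Id_mor)
  have "inv\<^bsub>Hom T (Sus T O0) (Sus T M)\<^esub> (SusM T (zero_mor T O0 M)) = zero_mor T (Sus T O0) (Sus T M)"
    using SusM_zero[OF O0 M] by simp
  then have "Tri T O0 M M (zero_mor T O0 M) (Ide T M) (zero_mor T M (Sus T O0))"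
    using Tri_rotate[OF cand] Tri_Id[OF M SZ0] by simp
  moreover have "g \<bullet> u = zero_mor T O0 M \<bullet> zero_mor T X O0"
    using gu zero_comp[OF O(1) O0 M] O O0 by (simp add: zero_mor_closed)
  ultimately obtain h where "h \<in> mor T Z M" "h \<bullet> v = Ide T M \<bullet> g"
    using Tri_fill[OF tri _ zero_mor_closed[OF O(1) O0] g] by blast
  then show thesis
    using that Id_Comp[OF O(2) M g] by simp
qed

text \<open>
  The four lemma for \<open>\<Sigma>X\<close>, \<open>Z\<close>, \<open>Y\<close>, \<open>X\<close>. Given \<open>f : Z \<rightarrow> C\<close>, the composite \<open>f \<bullet> v\<close> is a
  finite sum of components \<open>y i : Y \<rightarrow> M i\<close>. These vanish on \<open>X\<close>, since \<open>f \<bullet> v\<close> does and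
  components are unique, so they extend along \<open>v\<close> to \<open>z i : Z \<rightarrow> M i\<close>. The difference \<open>r\<close> of \<open>f\<close> and the
  component sum of the \<open>z i\<close> vanishes on \<open>Y\<close>, hence factors through \<open>\<Sigma>X\<close>, where compactness
  applies again.
\<close>

lemma compact_cone:
  assumes tri: "Tri T X Y Z u v w" and X: "compact_object sml T X" and Y: "compact_object sml T Y"
  shows "compact_object sml T Z"
proof -
  have O: "X \<in> Obj T" "Y \<in> Obj T" "Z \<in> Obj T"
    and u: "u \<in> mor T X Y" and v: "v \<in> mor T Y Z" and w: "w \<in> mor T Z (Sus T X)"
    using Tri_candidate[OF tri] by (auto simp: candidate_triangle_def)
  have SX: "Sus T X \<in> Obj T" using O by (simp add: Sus_Obj)
  have tri': "Tri T Y Z (Sus T X) v w (inv\<^bsub>Hom T (Sus T X) (Sus T Y)\<^esub> (SusM T u))"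
    using Tri_rotate[OF Tri_candidate[OF tri]] tri by simp
  have "f \<in> component_sum T I C \<iota> Z ` finite_families T I M Z"
    if I: "sml I" and M: "\<forall>i\<in>I. M i \<in> Obj T" and cop: "is_coproduct T I M C \<iota>"
      and f: "f \<in> mor T Z C" for I M C \<iota> f
  proof -
    have M: "\<And>i. i \<in> I \<Longrightarrow> M i \<in> Obj T" using M by blast
    have C: "C \<in> Obj T" and \<iota>: "\<And>i. i \<in> I \<Longrightarrow> \<iota> i \<in> mor T (M i) C"
      using cop by (auto simp: is_coproduct_def)
    have fv: "f \<bullet> v \<in> mor T Y C"
      using Comp_mor[OF O(2,3) C v f] .
    then obtain y where y: "y \<in> finite_families T I M Y" and fy: "f \<bullet> v = component_sum T I C \<iota> Y y"
      using Y I M cop unfolding compact_object_iff_component_sums by blast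
    have ym: "\<And>i. i \<in> I \<Longrightarrow> y i \<in> mor T Y (M i)" and yfin: "finite {i \<in> I. y i \<noteq> zero_mor T Y (M i)}"
      using y by (auto simp: finite_families_def)
    have yu: "y i \<bullet> u = zero_mor T X (M i)" if i: "i \<in> I" for i
    proof -
      obtain p where p: "p \<in> mor T C (M i)"
        and ps: "\<And>X x. X \<in> Obj T \<Longrightarrow> x \<in> finite_families T I M X \<Longrightarrow> p \<bullet> component_sum T I C \<iota> X x = x i"
        using coproduct_projection[OF M cop i] by blast
      have "component_sum T I C \<iota> X (\<lambda>i. y i \<bullet> u) = (f \<bullet> v) \<bullet> u"
        using component_sum_comp(2)[OF M C \<iota> O(1,2) y u] fy by simp
      also have "\<dots> = zero_mor T X C"
        using Comp_assoc[OF O(1,2,3) C u v f] Tri_comp_zero[OF tri] comp_zero[OF O(1,3) C f] by simp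
      finally show ?thesis
        using ps[OF O(1) component_sum_comp(1)[OF M C \<iota> O(1,2) y u]] comp_zero[OF O(1) C M[OF i] p] by simp
    qed
    \<comment> \<open>Zero entries must be extended by zero, lest the new family lose its finite support.\<close>
    have "\<exists>t. t \<in> mor T Z (M i) \<and> t \<bullet> v = y i \<and> (y i = zero_mor T Y (M i) \<longrightarrow> t = zero_mor T Z (M i))"
      if i: "i \<in> I" for i
    proof (cases "y i = zero_mor T Y (M i)")
      case True
      then show ?thesis
        using zero_comp[OF O(2,3) M[OF i] v] zero_mor_closed[OF O(3) M[OF i]] by auto
    next
      case False
      then show ?thesis
        using Tri_weak_cokernel[OF tri M[OF i] ym[OF i] yu[OF i]] by metis
    qed
    then obtain z where zm: "\<And>i. i \<in> I \<Longrightarrow> z i \<in> mor T Z (M i)" and zv: "\<And>i. i \<in> I \<Longrightarrow> z i \<bullet> v = y i"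
      and zz: "\<And>i. i \<in> I \<Longrightarrow> y i = zero_mor T Y (M i) \<Longrightarrow> z i = zero_mor T Z (M i)"
      by metis
    have "finite {i \<in> I. z i \<noteq> zero_mor T Z (M i)}"
      by (rule finite_subset[OF _ yfin]) (use zz in auto)
    then have z: "z \<in> finite_families T I M Z"
      using zm by (simp add: finite_families_def)
    interpret ZC: comm_group "Hom T Z C" using O C by (intro Hom_group)
    interpret YC: comm_group "Hom T Y C" using O C by (intro Hom_group)
    let ?s = "component_sum T I C \<iota> Z z"
    have s: "?s \<in> mor T Z C"
      using component_sum_closed[OF M C \<iota> O(3) z] .
    have sv: "?s \<bullet> v = f \<bullet> v"
    proof -
      have "?s \<bullet> v = component_sum T I C \<iota> Y (\<lambda>i. z i \<bullet> v)"
        using component_sum_comp(2)[OF M C \<iota> O(2,3) z v] by simp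
      also have "\<dots> = component_sum T I C \<iota> Y y"
        by (rule component_sum_cong[OF M C \<iota> O(2) y]) (simp_all add: zv)
      finally show ?thesis
        by (simp only: fy)
    qed
    define r where "r = inv\<^bsub>Hom T Z C\<^esub> ?s \<otimes>\<^bsub>Hom T Z C\<^esub> f"
    have r: "r \<in> mor T Z C" using s f by (simp add: r_def)
    interpret v: group_hom "Hom T Z C" "Hom T Y C" "\<lambda>g. g \<bullet> v"
      using comp_right_hom[OF O(2,3) C v] by unfold_locales
    have "r \<bullet> v = zero_mor T Y C"
      using s f fv by (simp add: r_def sv YC.l_inv)
    then obtain g where g: "g \<in> mor T (Sus T X) C" and gw: "g \<bullet> w = r"
      using Tri_weak_cokernel[OF tri' C r] by blast
    obtain x where x: "x \<in> finite_families T I M (Sus T X)" and gx: "g = component_sum T I C \<iota> (Sus T X) x"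
      using compact_Sus[OF X] I M cop g unfolding compact_object_iff_component_sums by blast
    have xw: "(\<lambda>i. x i \<bullet> w) \<in> finite_families T I M Z"
      using component_sum_comp(1)[OF M C \<iota> O(3) SX x w] by simp
    have "f = ?s \<otimes>\<^bsub>Hom T Z C\<^esub> r"
      using s f by (simp add: r_def ZC.m_assoc[symmetric] ZC.r_inv)
    also have "r = component_sum T I C \<iota> Z (\<lambda>i. x i \<bullet> w)"
      using component_sum_comp(2)[OF M C \<iota> O(3) SX x w] gw gx by simp
    also have "?s \<otimes>\<^bsub>Hom T Z C\<^esub> component_sum T I C \<iota> Z (\<lambda>i. x i \<bullet> w) =
        component_sum T I C \<iota> Z (\<lambda>i. z i \<otimes>\<^bsub>Hom T Z (M i)\<^esub> (x i \<bullet> w))"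
      using component_sum_add(2)[OF M C \<iota> O(3) z xw] by simp
    finally show ?thesis
      by (rule image_eqI[where x = "\<lambda>i. z i \<otimes>\<^bsub>Hom T Z (M i)\<^esub> (x i \<bullet> w)"])
        (rule component_sum_add(1)[OF M C \<iota> O(3) z xw])
  qed
  then show ?thesis
    unfolding compact_object_iff_component_sums using O by blast
qed


section \<open>Annihilators of finitely many morphisms\<close>

text \<open>
  If the morphisms \<open>X \<rightarrow> M\<close> killing the first \<open>n\<close> of the \<open>a k\<close> are the multiples \<open>f \<bullet> b\<close>, then such a
  multiple kills \<open>a n\<close> as well if and only if \<open>f\<close> kills \<open>b \<bullet> a n\<close>, that is, if and only if \<open>f\<close> factors
  through the map \<open>c\<close> from \<open>Y\<close> to the cone of \<open>b \<bullet> a n\<close>; so \<open>c \<bullet> b\<close> takes the place of \<open>b\<close>.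
\<close>

lemma annihilator_eq_multiples:
  fixes n :: nat
  assumes X: "compact_object sml T X" and M: "M \<in> Obj T"
    and D: "\<And>k. compact_object sml T (D k)" and a: "\<And>k. a k \<in> mor T (D k) X"
  shows "\<exists>Y b. compact_object sml T Y \<and> b \<in> mor T X Y \<and>
    {g \<in> mor T X M. \<forall>k<n. g \<bullet> a k = zero_mor T (D k) M} = {f \<bullet> b | f. f \<in> mor T Y M}"
proof (induction n)
  case 0
  have XO: "X \<in> Obj T" using X by (simp add: compact_object_def)
  have "mor T X M = {f \<bullet> Ide T X | f. f \<in> mor T X M}"
    using Comp_Id[OF XO M] by force
  then show ?case
    using X Id_mor[OF XO] by auto
next
  case (Suc n)
  then obtain Y b where Y: "compact_object sml T Y" and b: "b \<in> mor T X Y"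
    and IH: "{g \<in> mor T X M. \<forall>k<n. g \<bullet> a k = zero_mor T (D k) M} = {f \<bullet> b | f. f \<in> mor T Y M}"
    by blast
  have O: "X \<in> Obj T" "Y \<in> Obj T" "D n \<in> Obj T"
    using X Y D by (auto simp: compact_object_def)
  have ba: "b \<bullet> a n \<in> mor T (D n) Y"
    using Comp_mor[OF O(3,1,2) a b] .
  obtain Z c w where tri: "Tri T (D n) Y Z (b \<bullet> a n) c w"
    using Tri_cone[OF O(3,2) ba] by blast
  have ZO: "Z \<in> Obj T" and c: "c \<in> mor T Y Z"
    using Tri_candidate[OF tri] by (auto simp: candidate_triangle_def)
  have split: "f \<bullet> (b \<bullet> a n) = zero_mor T (D n) M \<longleftrightarrow> (\<exists>f' \<in> mor T Z M. f = f' \<bullet> c)"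
    if f: "f \<in> mor T Y M" for f
  proof
    assume "f \<bullet> (b \<bullet> a n) = zero_mor T (D n) M"
    then show "\<exists>f' \<in> mor T Z M. f = f' \<bullet> c"
      using Tri_weak_cokernel[OF tri M f] by metis
  next
    assume "\<exists>f' \<in> mor T Z M. f = f' \<bullet> c"
    then obtain f' where f': "f' \<in> mor T Z M" "f = f' \<bullet> c" by blast
    then show "f \<bullet> (b \<bullet> a n) = zero_mor T (D n) M"
      using Comp_assoc[OF O(3,2) ZO M ba c f'(1)] Tri_comp_zero[OF tri] comp_zero[OF O(3) ZO M f'(1)]
      by simp
  qed
  have "{g \<in> mor T X M. \<forall>k<Suc n. g \<bullet> a k = zero_mor T (D k) M} =
      {g \<in> {g \<in> mor T X M. \<forall>k<n. g \<bullet> a k = zero_mor T (D k) M}. g \<bullet> a n = zero_mor T (D n) M}"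
    by (auto simp: less_Suc_eq)
  also have "\<dots> = {f \<bullet> b | f. f \<in> mor T Y M \<and> (f \<bullet> b) \<bullet> a n = zero_mor T (D n) M}"
    unfolding IH by auto
  also have "\<dots> = {f \<bullet> b | f. f \<in> mor T Y M \<and> (\<exists>f' \<in> mor T Z M. f = f' \<bullet> c)}"
  proof -
    have "(f \<bullet> b) \<bullet> a n = zero_mor T (D n) M \<longleftrightarrow> (\<exists>f' \<in> mor T Z M. f = f' \<bullet> c)"
      if "f \<in> mor T Y M" for f
      using Comp_assoc[OF O(3,1,2) M a b that] split[OF that] by simp
    then show ?thesis
      by auto
  qed
  also have "\<dots> = {(f' \<bullet> c) \<bullet> b | f'. f' \<in> mor T Z M}"
    using Comp_mor[OF O(2) ZO M c] by blast
  also have "\<dots> = {f' \<bullet> (c \<bullet> b) | f'. f' \<in> mor T Z M}"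
    using Comp_assoc[OF O(1,2) ZO M b c] by force
  finally show ?case
    using compact_cone[OF tri D Y] Comp_mor[OF O(1,2) ZO b c] by blast
qed

lemma subgroup_annihilator:
  assumes X: "X \<in> Obj T" and M: "M \<in> Obj T"
    and D: "\<And>k. k \<in> K \<Longrightarrow> D k \<in> Obj T" and a: "\<And>k. k \<in> K \<Longrightarrow> a k \<in> mor T (D k) X"
  shows "subgroup {g \<in> mor T X M. \<forall>k\<in>K. g \<bullet> a k = zero_mor T (D k) M} (Hom T X M)"
proof -
  interpret XM: group "Hom T X M" using X M by (intro Hom_is_group)
  have gh: "group_hom (Hom T X M) (Hom T (D k) M) (\<lambda>g. g \<bullet> a k)" if "k \<in> K" for k
    using comp_right_hom[OF D X M a] Hom_is_group X M D that
    by (simp add: group_hom_def group_hom_axioms_def)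
  show ?thesis
  proof (rule XM.subgroupI)
    show "{g \<in> mor T X M. \<forall>k\<in>K. g \<bullet> a k = zero_mor T (D k) M} \<noteq> {}"
      using group_hom.hom_one[OF gh] by auto
  next
    fix g assume "g \<in> {g \<in> mor T X M. \<forall>k\<in>K. g \<bullet> a k = zero_mor T (D k) M}"
    then show "inv\<^bsub>Hom T X M\<^esub> g \<in> {g \<in> mor T X M. \<forall>k\<in>K. g \<bullet> a k = zero_mor T (D k) M}"
      using group_hom.hom_inv[OF gh] Hom_is_group[OF D M] by (auto simp: group.is_monoid monoid.inv_one)
  next
    fix g h assume "g \<in> {g \<in> mor T X M. \<forall>k\<in>K. g \<bullet> a k = zero_mor T (D k) M}"
      "h \<in> {g \<in> mor T X M. \<forall>k\<in>K. g \<bullet> a k = zero_mor T (D k) M}"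
    then show "g \<otimes>\<^bsub>Hom T X M\<^esub> h \<in> {g \<in> mor T X M. \<forall>k\<in>K. g \<bullet> a k = zero_mor T (D k) M}"
      using group_hom.hom_mult[OF gh] Hom_is_group[OF D M] by (auto simp: group.is_monoid monoid.l_one)
  qed auto
qed

end


section \<open>From annihilator subobjects to pp-definable subgroups\<close>

lemma module_mor_comp:
  assumes \<eta>: "\<eta> \<in> module_mor A P Q" and \<zeta>: "\<zeta> \<in> module_mor A Q R"
  shows "(\<lambda>X p. \<zeta> X (\<eta> X p)) \<in> module_mor A P R"
proof -
  have hom: "(\<lambda>p. \<zeta> X (\<eta> X p)) \<in> hom (Grp P X) (Grp R X)" if "X \<in> Obj A" for X
    using Group.hom_compose[of "\<eta> X" "Grp P X" "Grp Q X" "\<zeta> X" "Grp R X"] \<eta> \<zeta> that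
    by (simp add: module_mor_def comp_def)
  have "\<zeta> X (\<eta> X (Act P f p)) = Act R f (\<zeta> Y (\<eta> Y p))"
    if "X \<in> Obj A" "Y \<in> Obj A" "f \<in> mor A X Y" "p \<in> carrier (Grp P Y)" for X Y f p
  proof -
    have "\<eta> Y p \<in> carrier (Grp Q Y)"
      using \<eta> that by (auto simp: module_mor_def intro: hom_in_carrier)
    then show ?thesis
      using \<eta> \<zeta> that by (simp add: module_mor_def)
  qed
  then show ?thesis
    using hom by (simp add: module_mor_def)
qed

text \<open>
  The Yoneda lemma; it applies to the restricted functors as long as \<open>X\<close> belongs to the subcategory.
\<close>

lemma yoneda_morphism:
  assumes "preadditive_category A" and S: "S \<subseteq> Obj A" and X: "X \<in> S"
    and \<eta>: "\<eta> \<in> module_mor (full_subcategory A S) (yoneda A X) (yoneda A M)"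
    and D: "D \<in> S" and a: "a \<in> mor A D X"
  shows "\<eta> X (Ide A X) \<in> mor A X M" and "\<eta> D a = \<eta> X (Ide A X) \<bullet>\<^bsub>A\<^esub> a"
proof -
  interpret preadditive_category A by fact
  have XO: "X \<in> Obj A" "D \<in> Obj A" using S X D by auto
  have "\<eta> X \<in> hom (Hom A X X) (Hom A X M)"
    using \<eta> X by (simp add: module_mor_def full_subcategory_def yoneda_def)
  then show "\<eta> X (Ide A X) \<in> mor A X M"
    using Id_mor[OF XO(1)] hom_in_carrier by fast
  have "\<eta> D (Ide A X \<bullet>\<^bsub>A\<^esub> a) = \<eta> X (Ide A X) \<bullet>\<^bsub>A\<^esub> a"
    using \<eta> X D a Id_mor[OF XO(1)] by (simp add: module_mor_def full_subcategory_def yoneda_def)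
  then show "\<eta> D a = \<eta> X (Ide A X) \<bullet>\<^bsub>A\<^esub> a"
    using Id_Comp[OF XO(2,1) a] by simp
qed

theorem lemma5p4:
  fixes sml :: "'u set \<Rightarrow> bool"
    and T :: "('o, 'm) tri_cat"
    and Q :: "('o, 'm, 'q) cat_module"
    and \<pi> :: "'o \<Rightarrow> 'm \<Rightarrow> 'q"
    and M X :: 'o
  assumes "smallness sml"
    and "triangulated_category T"
    and "has_small_coproducts sml T"
    and "compactly_generated sml T"
    and "skeletally_small sml (compacts sml T)"
    and "M \<in> Obj T"
    and "X \<in> Obj (compacts sml T)"
    and "right_module (compacts sml T) Q"
    and "exact_at (compacts sml T) (yoneda T X) Q zero_module \<pi> (\<lambda>_ _. ())"
    and "\<exists>P :: nat \<Rightarrow> 'o \<Rightarrow> 'q set.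
           (\<forall>n. annihilator_subobject (compacts sml T) Q (yoneda T M) (P n)) \<and>
           (\<forall>n. proper_submodule (compacts sml T) (P n) (P (Suc n)))"
  shows "\<exists>H :: nat \<Rightarrow> 'm set.
           (\<forall>n. pp_definable_subgroup sml T M X (H n)) \<and>
           (\<forall>n. H (Suc n) \<subset> H n)"
proof -
  interpret triangulated_category T by fact
  let ?C = "compacts sml T"
  have Cobj: "Obj ?C = {X. compact_object sml T X}" and Cmor: "Hom ?C = Hom T"
    by (auto simp: compacts_def full_subcategory_def)
  have CO: "{X. compact_object sml T X} \<subseteq> Obj T"
    by (auto simp: compact_object_def)
  note M = \<open>M \<in> Obj T\<close>
  have X: "compact_object sml T X" using assms(7) by (simp add: Cobj)
  then have XO: "X \<in> Obj T" using CO by blast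
  have \<pi>: "\<pi> \<in> module_mor ?C (yoneda T X) Q"
    and \<pi>_surj: "\<pi> D ` mor T D X = carrier (Grp Q D)" if "compact_object sml T D" for D
    using assms(9) that
    by (auto simp: exact_at_def Cobj im_mor_def ker_mor_def kernel_def yoneda_def zero_module_def
        singleton_group_def)
  obtain P where ann: "\<And>n. annihilator_subobject ?C Q (yoneda T M) (P n)"
    and chain: "\<And>n. proper_submodule ?C (P n) (P (Suc n))"
    using assms(10) by blast
  have mono: "P m D \<subseteq> P n D" if "m \<le> n" "compact_object sml T D" for m n D
    by (rule lift_Suc_mono_le[of "\<lambda>n. P n D"])
      (use that chain in \<open>auto simp: proper_submodule_def Cobj\<close>)
  \<comment> \<open>\<open>a\<close> represents an element that is new in step \<open>n + 1\<close>, and \<open>g\<close> a morphism killing step \<open>n\<close> but not \<open>a\<close>.\<close>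
  define separates where "separates n D a g \<longleftrightarrow>
      compact_object sml T D \<and> a \<in> mor T D X \<and> g \<in> mor T X M \<and> \<pi> D a \<in> P (Suc n) D \<and>
      g \<bullet>\<^bsub>T\<^esub> a \<noteq> zero_mor T D M \<and>
      (\<forall>E c. compact_object sml T E \<longrightarrow> c \<in> mor T E X \<longrightarrow> \<pi> E c \<in> P n E \<longrightarrow> g \<bullet>\<^bsub>T\<^esub> c = zero_mor T E M)"
    for n D a g
  have "\<exists>D a g. separates n D a g" for n
  proof -
    obtain D q where D: "compact_object sml T D" and q: "q \<in> P (Suc n) D" "q \<notin> P n D"
      using chain[of n] by (auto simp: proper_submodule_def Cobj)
    obtain K where K: "K \<subseteq> module_mor ?C Q (yoneda T M)"
      and PK: "\<And>E. compact_object sml T E \<Longrightarrow>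
        P n E = carrier (Grp Q E) \<inter> (\<Inter>\<eta>\<in>K. ker_mor Q (yoneda T M) \<eta> E)"
      using ann[of n] by (auto simp: annihilator_subobject_def Cobj)
    have "q \<in> carrier (Grp Q D)"
      using q(1) ann[of "Suc n"] D by (auto simp: annihilator_subobject_def Cobj)
    then obtain a where a: "a \<in> mor T D X" and qa: "q = \<pi> D a"
      using \<pi>_surj[OF D] by blast
    obtain \<eta> where \<eta>: "\<eta> \<in> K" and \<eta>q: "\<eta> D q \<noteq> zero_mor T D M"
      using q(2) \<open>q \<in> carrier (Grp Q D)\<close> PK[OF D] by (auto simp: ker_mor_def kernel_def yoneda_def)
    let ?\<theta> = "\<lambda>E c. \<eta> E (\<pi> E c)"
    have \<theta>: "?\<theta> \<in> module_mor ?C (yoneda T X) (yoneda T M)"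
      using module_mor_comp[OF \<pi>[OF X]] K \<eta> by blast
    note \<theta>' = \<theta>[unfolded compacts_def]
    let ?g = "?\<theta> X (Ide T X)"
    have g: "?g \<in> mor T X M"
      by (rule yoneda_morphism(1)[OF preadditive_category_axioms CO _ \<theta>' _ a]) (use X D in auto)
    have gc: "?\<theta> E c = ?g \<bullet>\<^bsub>T\<^esub> c" if "compact_object sml T E" "c \<in> mor T E X" for E c
      by (rule yoneda_morphism(2)[OF preadditive_category_axioms CO _ \<theta>' _ that(2)]) (use X that in auto)
    have "?g \<bullet>\<^bsub>T\<^esub> a \<noteq> zero_mor T D M"
      using gc[OF D a] \<eta>q qa by simp
    moreover have "?g \<bullet>\<^bsub>T\<^esub> c = zero_mor T E M"
      if "compact_object sml T E" "c \<in> mor T E X" "\<pi> E c \<in> P n E" for E c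
      using gc[OF that(1,2)] that(3) PK[OF that(1)] \<eta> by (auto simp: ker_mor_def kernel_def yoneda_def)
    ultimately have "separates n D a ?g"
      using D a g q(1) qa unfolding separates_def by blast
    then show ?thesis
      by blast
  qed
  then obtain D a g where "\<And>n. separates n (D n) (a n) (g n)"
    by metis
  then have D: "\<And>n. compact_object sml T (D n)" and a: "\<And>n. a n \<in> mor T (D n) X"
    and g: "\<And>n. g n \<in> mor T X M" and aP: "\<And>n. \<pi> (D n) (a n) \<in> P (Suc n) (D n)"
    and ga: "\<And>n. g n \<bullet>\<^bsub>T\<^esub> a n \<noteq> zero_mor T (D n) M"
    and g0: "\<And>n E c. compact_object sml T E \<Longrightarrow> c \<in> mor T E X \<Longrightarrow> \<pi> E c \<in> P n E \<Longrightarrow>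
      g n \<bullet>\<^bsub>T\<^esub> c = zero_mor T E M"
    unfolding separates_def by blast+
  define H where "H n = {h \<in> mor T X M. \<forall>k<n. h \<bullet>\<^bsub>T\<^esub> a k = zero_mor T (D k) M}" for n
  have "pp_definable_subgroup sml T M X (H n)" for n
  proof -
    have "subgroup (H n) (Hom T X M)"
    proof -
      have "H n = {h \<in> mor T X M. \<forall>k\<in>{..<n}. h \<bullet>\<^bsub>T\<^esub> a k = zero_mor T (D k) M}"
        by (auto simp: H_def)
      then show ?thesis
        using subgroup_annihilator[OF XO M, of "{..<n}" D a] D CO a by auto
    qed
    moreover obtain Y b where Y: "compact_object sml T Y" and b: "b \<in> mor T X Y"
      and "H n = {f \<bullet>\<^bsub>T\<^esub> b | f. f \<in> mor T Y M}"
      using annihilator_eq_multiples[where n = n and D = D and a = a, OF X M D a] unfolding H_def by blast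
    moreover have "Y \<in> Obj ?C" "b \<in> mor ?C X Y"
      using Y b by (simp_all add: Cobj Cmor)
    ultimately show ?thesis
      unfolding pp_definable_subgroup_def by (intro conjI bexI)
  qed
  moreover have "H (Suc n) \<subset> H n" for n
  proof -
    have "g n \<bullet>\<^bsub>T\<^esub> a k = zero_mor T (D k) M" if "k < n" for k
    proof (rule g0[OF D a])
      show "\<pi> (D k) (a k) \<in> P n (D k)"
        using aP[of k] mono[OF _ D, of "Suc k" n k] that by auto
    qed
    then have "g n \<in> H n"
      using g by (simp add: H_def)
    moreover have "g n \<notin> H (Suc n)"
      using ga by (auto simp: H_def)
    ultimately show ?thesis
      by (auto simp: H_def)
  qed
  ultimately show ?thesis
    by blast
qed

end
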